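(* Let $(C_n,\Pi)$ be a parcycle with $\Pi=\{V_1,\dots,V_k\}$ and $n\in V_k$, and let $B_\Pi$ be its labelled polyhedral complex obtained from the hyperplane arrangement $\tilde{\mathcal{A}}_\Pi$. Then the cellular free complex $\mathcal{H}_\Pi$ obtained from the labelled polyhedral complex $B_\Pi$ is a minimal free resolution of $R/M_\Pi$, where $R=R_n=\mathbb{K}[x_1,\dots,x_n]$ over a field $\mathbb{K}$ and $M_\Pi$ is the $G$-parking function ideal of $(C_n,\Pi)$ with sink $V_k$.
   Context: For $n\ge3$, $C_n$ is the cycle with vertices $1,\dots,n$ and edges $\{i,i+1\}$ ($1\le i\le n-1$), $\{1,n\}$. A parcycle $(C_n,\Pi)$ is $C_n$ with a partition $\Pi=\{V_1,\dots,V_k\}$ of its vertex set such that every $V_i$ induces a connected subgraph; the $V_i$ are the main vertices. A relevant edge is an edge of $C_n$ whose endpoints lie in different main vertices. A connected-parset is a nonempty union of main vertices inducing a connected subgraph. For a union $S$ of main vertices with complement $\overline S$, $\mathbf{x}^{S\to\overline S}=\prod_{i\in S}x_i^{d_i}$, where $d_i$ is the number of edges from $i$ to $\overline S$. $M_\Pi=\langle\mathbf{x}^{S\to\overline S}: S\text{ a connected-parset not containing }V_k\rangle\subset R_n$. For a relevant edge $\{i,j\}$ let $h_{ij}=\{\mathbf{p}\in\mathbb{R}^n: p_i=p_j\}$. Let $$U_\Pi=\{\mathbf{p}\in\mathbb{R}^n: p_n=0,\ p_1+\dots+p_{n-1}=1,\ p_u=p_w\text{ whenever }\{u,w\}\subseteq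 V_i\text{ for some }i\}$$ and $\tilde{\mathcal{A}}_\Pi=\{h_{ij}\cap U_\Pi: \{i,j\}\text{ a relevant edge}\}$. This arrangement subdivides $U_\Pi$ into (closed) polyhedra of various dimensions, called cells; $B_\Pi$ is the polyhedral complex of all bounded cells. Labels: the $0$-cells of $B_\Pi$ are exactly the points $u=\chi_J/|J|$ with $J\subseteq\{1,\dots,n-1\}$ a connected-parset ($\chi_J$ the characteristic vector); such a $0$-cell is labelled by the exponent vector $a_u$ with $a_u(i)$ equal to the number of edges of $C_n$ from $i$ to $\overline J$ if $i\in J$ and $0$ otherwise, i.e. by the monomial $\mathbf{x}^{J\to\overline J}$. A cell $B$ is labelled by $m_B=\mathbf{x}^{a_B}$ with $a_B(i)=\max\{a_u(i): u\text{ a }0\text{-cell of }B\}$; the empty cell is labelled by $1$. $\mathcal{H}_\Pi$ is the cellular complex of the labelled complex $B_\Pi$: its module in homological degree $i\geq 0$ is $\bigoplus_B R_n e_B$ over the $(i-1)$-dimensional cells $B$ of $B_\Pi$ (the empty cell, of dimension $-1$, in degree $0$), with differential $\rho(e_B)=\sum_{B'}\varepsilon(B,B')\frac{m_B}{m_{B'}}e_{B'}$, summed over the facets $B'$ of $B$, where $\varepsilon$ is the usual incidence function with values in $\{0,1,-1\}$ of the polyhedral complex. *)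

theory Defs
  imports
    "HOL-Analysis.Analysis"
    "HOL-Library.Disjoint_Sets"
    "HOL-Library.Poly_Mapping"
begin

section \<open>Parcycles\<close>

text \<open>
  The vertices of \<open>C\<^sub>n\<close> are the elements of a finite type \<open>'n\<close>, numbered by a bijection \<open>v\<close> from
  \<open>{1..n}\<close> onto \<open>'n\<close>: the vertex called \<open>i\<close> on paper is \<open>v i\<close>. This way \<open>real ^ 'n\<close> is
  \<open>n\<close>-dimensional space, and the polynomials with indeterminates indexed by \<open>'n\<close> are all of
  \<open>K[x\<^sub>1, \<dots>, x\<^sub>n]\<close>.
\<close>

definition cycle_edges :: "nat \<Rightarrow> (nat \<Rightarrow> 'n) \<Rightarrow> 'n set set" where
  "cycle_edges n v = {{v i, v (i + 1)} | i. 1 \<le> i \<and> i \<le> n - 1} \<union> {{v 1, v n}}"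

definition induces_connected :: "'n set set \<Rightarrow> 'n set \<Rightarrow> bool" where
  "induces_connected E S \<longleftrightarrow>
     (\<forall>a\<in>S. \<forall>b\<in>S. (a, b) \<in> {(u, w). u \<in> S \<and> w \<in> S \<and> {u, w} \<in> E}\<^sup>*)"

definition parcycle :: "nat \<Rightarrow> (nat \<Rightarrow> 'n) \<Rightarrow> 'n set set \<Rightarrow> bool" where
  "parcycle n v P \<longleftrightarrow>
     n \<ge> 3 \<and> bij_betw v {1..n} UNIV \<and> partition_on UNIV P \<and>
     (\<forall>V\<in>P. induces_connected (cycle_edges n v) V)"

definition connected_parset :: "'n set set \<Rightarrow> 'n set set \<Rightarrow> 'n set \<Rightarrow> bool" where
  "connected_parset E P S \<longleftrightarrow> S \<noteq> {} \<and> (\<exists>A\<subseteq>P. S = \<Union>A) \<and> induces_connected E S"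

definition relevant_edge :: "'n set set \<Rightarrow> 'n set set \<Rightarrow> 'n \<Rightarrow> 'n \<Rightarrow> bool" where
  "relevant_edge E P a b \<longleftrightarrow> {a, b} \<in> E \<and> \<not> (\<exists>V\<in>P. a \<in> V \<and> b \<in> V)"

text \<open>The exponent vector of \<open>x\<^bsup>S\<rightarrow>-S\<^esup>\<close>.\<close>

definition out_degree :: "'n set set \<Rightarrow> 'n set \<Rightarrow> 'n \<Rightarrow> nat" where
  "out_degree E S i = (if i \<in> S then card {j. j \<notin> S \<and> {i, j} \<in> E} else 0)"


section \<open>The polynomial ring and the ideal\<close>

type_synonym ('n, 'k) mpoly = "('n \<Rightarrow>\<^sub>0 nat) \<Rightarrow>\<^sub>0 'k"

definition indet :: "'n \<Rightarrow> ('n, 'k::field) mpoly" where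
  "indet i = Poly_Mapping.single (Poly_Mapping.single i 1) 1"

definition monom :: "('n::finite \<Rightarrow> nat) \<Rightarrow> ('n, 'k::field) mpoly" where
  "monom a = (\<Prod>i\<in>UNIV. indet i ^ a i)"

lemma module_times: "module ((*) :: 'a::comm_ring_1 \<Rightarrow> 'a \<Rightarrow> 'a)"
  by unfold_locales (simp_all add: algebra_simps)

definition ideal_gen :: "'a::comm_ring_1 set \<Rightarrow> 'a set" where
  "ideal_gen S = module.span (*) S"

definition parking_ideal :: "'n::finite set set \<Rightarrow> 'n set set \<Rightarrow> 'n set \<Rightarrow> ('n, 'k::field) mpoly set" where
  "parking_ideal E P Vk =
     ideal_gen {monom (out_degree E S) | S. connected_parset E P S \<and> \<not> Vk \<subseteq> S}"


section \<open>The complex of bounded cells\<close>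

definition affine_space_U :: "nat \<Rightarrow> (nat \<Rightarrow> 'n) \<Rightarrow> 'n::finite set set \<Rightarrow> (real ^ 'n) set" where
  "affine_space_U n v P =
     {p. p $ v n = 0 \<and> (\<Sum>i = 1..n - 1. p $ v i) = 1 \<and>
         (\<forall>V\<in>P. \<forall>u\<in>V. \<forall>w\<in>V. p $ u = p $ w)}"

text \<open>
  Two points of \<open>U\<close> lie in the same relatively open cell iff they lie on the same side of (or both on)
  every hyperplane \<open>p\<^sub>a = p\<^sub>b\<close> of the arrangement. The cells are the closures of these classes.
\<close>

definition open_cell :: "nat \<Rightarrow> (nat \<Rightarrow> 'n) \<Rightarrow> 'n::finite set set \<Rightarrow> real ^ 'n \<Rightarrow> (real ^ 'n) set" where
  "open_cell n v P p =
     {q \<in> affine_space_U n v P. \<forall>a b. relevant_edge (cycle_edges n v) P a b \<longrightarrow>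
        sgn (q $ a - q $ b) = sgn (p $ a - p $ b)}"

definition arrangement_cells :: "nat \<Rightarrow> (nat \<Rightarrow> 'n) \<Rightarrow> 'n::finite set set \<Rightarrow> (real ^ 'n) set set" where
  "arrangement_cells n v P = {closure (open_cell n v P p) | p. p \<in> affine_space_U n v P}"

text \<open>The empty cell, of dimension \<open>-1\<close>, is included.\<close>

definition bounded_complex :: "nat \<Rightarrow> (nat \<Rightarrow> 'n) \<Rightarrow> 'n::finite set set \<Rightarrow> (real ^ 'n) set set" where
  "bounded_complex n v P = insert {} {B \<in> arrangement_cells n v P. bounded B}"

text \<open>Unlike \<^const>\<open>facet_of\<close>, this makes the empty cell a facet of every 0-cell.\<close>

definition cell_facet :: "'a::euclidean_space set \<Rightarrow> 'a set \<Rightarrow> bool" where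
  "cell_facet B' B \<longleftrightarrow> B' face_of B \<and> aff_dim B' = aff_dim B - 1"

text \<open>
  The third condition says that the boundary of a boundary vanishes: in a polyhedral complex,
  the sum has two terms if \<open>B''\<close> is a face of codimension 2 of \<open>B\<close>, and none otherwise.
\<close>

definition incidence_function :: "'a::euclidean_space set set \<Rightarrow> ('a set \<Rightarrow> 'a set \<Rightarrow> int) \<Rightarrow> bool" where
  "incidence_function X \<epsilon> \<longleftrightarrow>
     (\<forall>B\<in>X. \<forall>B'\<in>X. \<epsilon> B B' \<in> {0, 1, -1} \<and> (\<epsilon> B B' \<noteq> 0 \<longleftrightarrow> cell_facet B' B)) \<and>
     (\<forall>B\<in>X. aff_dim B = 0 \<longrightarrow> \<epsilon> B {} = 1) \<and>
     (\<forall>B\<in>X. \<forall>B''\<in>X.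
        (\<Sum>B' | B' \<in> X \<and> cell_facet B' B \<and> cell_facet B'' B'. \<epsilon> B B' * \<epsilon> B' B'') = 0)"

definition barycentre :: "'n::finite set \<Rightarrow> real ^ 'n" where
  "barycentre J = (\<chi> i. indicator J i / real (card J))"

text \<open>The inserted \<open>0\<close> only matters for the empty cell, which thus has label 1.\<close>

definition cell_label :: "nat \<Rightarrow> (nat \<Rightarrow> 'n) \<Rightarrow> 'n::finite set set \<Rightarrow> (real ^ 'n) set \<Rightarrow> 'n \<Rightarrow> nat" where
  "cell_label n v P B i =
     Max (insert 0 {out_degree (cycle_edges n v) J i | J.
        connected_parset (cycle_edges n v) P J \<and> v n \<notin> J \<and>
        {barycentre J} \<in> bounded_complex n v P \<and> {barycentre J} face_of B})"


section \<open>Minimal free resolutions\<close>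

text \<open>
  The free \<open>R\<close>-module on a set \<open>X\<close> consists of the finitely supported functions vanishing off \<open>X\<close>;
  the basis element belonging to \<open>b\<close> is \<open>Poly_Mapping.single b 1\<close>.
\<close>

definition free_module :: "'c set \<Rightarrow> ('c \<Rightarrow>\<^sub>0 'r::comm_ring_1) set" where
  "free_module X = {f. Poly_Mapping.keys f \<subseteq> X}"

definition scale :: "'r::comm_ring_1 \<Rightarrow> ('c \<Rightarrow>\<^sub>0 'r) \<Rightarrow> ('c \<Rightarrow>\<^sub>0 'r)" where
  "scale r = Poly_Mapping.map ((*) r)"

definition homogeneous :: "('n \<Rightarrow> int) \<Rightarrow> ('n, 'k::field) mpoly \<Rightarrow> bool" where
  "homogeneous a p \<longleftrightarrow> (\<forall>t \<in> Poly_Mapping.keys p. \<forall>i. int (Poly_Mapping.lookup t i) = a i)"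

text \<open>
  The free modules \<open>F i\<close> with bases \<open>X i\<close>, the differential \<open>d\<close> (mapping \<open>F (i + 1)\<close> to \<open>F i\<close>) and
  the augmentation \<open>F 0 \<rightarrow> R/I\<close>, \<open>f \<mapsto> \<phi> f + I\<close>, form a minimal free resolution of \<open>R/I\<close>, which is
  multigraded with the basis element \<open>b\<close> in multidegree \<open>\<delta> b\<close>. Minimality is
  \<open>d (F (i + 1)) \<subseteq> \<langle>x\<^sub>1, \<dots>, x\<^sub>n\<rangle> F i\<close>.
\<close>

definition minimal_free_resolution ::
  "(nat \<Rightarrow> 'c set) \<Rightarrow> ('c \<Rightarrow> 'n \<Rightarrow> nat) \<Rightarrow>
   (('c \<Rightarrow>\<^sub>0 ('n, 'k::field) mpoly) \<Rightarrow> ('c \<Rightarrow>\<^sub>0 ('n, 'k) mpoly)) \<Rightarrow>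
   (('c \<Rightarrow>\<^sub>0 ('n, 'k) mpoly) \<Rightarrow> ('n, 'k) mpoly) \<Rightarrow> ('n, 'k) mpoly set \<Rightarrow> bool" where
  "minimal_free_resolution X \<delta> d \<phi> I \<longleftrightarrow> (let F = \<lambda>i. free_module (X i) in
     (\<forall>i. finite (X i)) \<and>
     \<comment> \<open>homomorphisms\<close>
     (\<forall>i. d ` F (i + 1) \<subseteq> F i) \<and>
     (\<forall>i. \<forall>f \<in> F (i + 1). \<forall>g \<in> F (i + 1). d (f + g) = d f + d g) \<and>
     (\<forall>i. \<forall>f \<in> F (i + 1). \<forall>r. d (scale r f) = scale r (d f)) \<and>
     (\<forall>f \<in> F 0. \<forall>g \<in> F 0. \<phi> (f + g) = \<phi> f + \<phi> g) \<and>
     (\<forall>f \<in> F 0. \<forall>r. \<phi> (scale r f) = r * \<phi> f) \<and>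
     \<comment> \<open>of multidegree zero\<close>
     (\<forall>i. \<forall>b \<in> X (i + 1). \<forall>b' \<in> X i.
        homogeneous (\<lambda>j. int (\<delta> b j) - int (\<delta> b' j))
          (Poly_Mapping.lookup (d (Poly_Mapping.single b 1)) b')) \<and>
     (\<forall>b \<in> X 0. homogeneous (\<lambda>j. int (\<delta> b j)) (\<phi> (Poly_Mapping.single b 1))) \<and>
     \<comment> \<open>exactness at \<open>F (i + 1)\<close>, at \<open>F 0\<close> and at \<open>R/I\<close>\<close>
     (\<forall>i. d ` F (i + 2) = {f \<in> F (i + 1). d f = 0}) \<and>
     d ` F 1 = {f \<in> F 0. \<phi> f \<in> I} \<and>
     (\<forall>r. \<exists>f \<in> F 0. r - \<phi> f \<in> I) \<and>
     \<comment> \<open>minimality\<close>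
     (\<forall>i. \<forall>f \<in> F (i + 1). \<forall>b. Poly_Mapping.lookup (d f) b \<in> ideal_gen (range indet)))"


section \<open>The cellular complex\<close>

definition cell_basis :: "nat \<Rightarrow> (nat \<Rightarrow> 'n) \<Rightarrow> 'n::finite set set \<Rightarrow> nat \<Rightarrow> (real ^ 'n) set set" where
  "cell_basis n v P i = {B \<in> bounded_complex n v P. aff_dim B = int i - 1}"

text \<open>
  Labels increase along inclusion of cells, so the truncated subtraction gives the exponent vector
  of \<open>m\<^sub>B / m\<^sub>B\<^sub>'\<close>.
\<close>

definition cellular_differential ::
  "nat \<Rightarrow> (nat \<Rightarrow> 'n) \<Rightarrow> 'n::finite set set \<Rightarrow> ((real ^ 'n) set \<Rightarrow> (real ^ 'n) set \<Rightarrow> int) \<Rightarrow>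
   ((real ^ 'n) set \<Rightarrow>\<^sub>0 ('n, 'k::field) mpoly) \<Rightarrow> ((real ^ 'n) set \<Rightarrow>\<^sub>0 ('n, 'k) mpoly)" where
  "cellular_differential n v P \<epsilon> f =
     (\<Sum>B \<in> Poly_Mapping.keys f. \<Sum>B' | B' \<in> bounded_complex n v P \<and> cell_facet B' B.
        scale (Poly_Mapping.lookup f B)
          (Poly_Mapping.single B'
            (of_int (\<epsilon> B B') * monom (\<lambda>i. cell_label n v P B i - cell_label n v P B' i))))"

end

theory Submission
  imports Defs
begin

text \<open>
  Going around the cycle from the vertex \<open>n\<close>, where a point \<open>p\<close> of \<open>U\<^sub>\<Pi>\<close> vanishes, \<open>p\<close> is determined
  by its jumps across the relevant edges, and its cell by the sets \<open>A\<close> and \<open>B\<close> of edges with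
  positive and with negative jump. The cell is bounded iff all edges of \<open>A\<close> come before all edges of
  \<open>B\<close> (otherwise the ray from \<open>p\<close> pointing away from the barycentre of \<open>{b..<a}\<close>, where \<open>b \<in> B\<close>,
  \<open>a \<in> A\<close>, \<open>b < a\<close>, stays in the cell). So the nonempty bounded cells correspond to pairs of nonempty sets \<open>A < B\<close>, have dimension \<open>|A| + |B| - 2\<close>, and
  passing to a facet removes one element of \<open>A\<close> or of \<open>B\<close>; the exponent of \<open>x\<^sub>i\<close> in the label is
  \<open>[i \<in> A] + [i + 1 \<in> B]\<close>.

  In multidegree \<open>u\<close> the complex becomes the chain complex over the field of the cells with label at
  most \<open>u\<close>. These are the pairs for which all \<open>(a, b) \<in> A \<times> B\<close> are admissible, and if \<open>(a, b)\<close> is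
  admissible then so is \<open>(a\<^sub>0, b)\<close> for the least \<open>a\<^sub>0\<close> occurring. Adding \<open>a\<^sub>0\<close> to \<open>A\<close> matches all
  cells except the empty one and those with \<open>A = {a\<^sub>0}\<close>, and adding a fixed \<open>b\<^sub>0\<close> to \<open>B\<close> matches the
  rest, so that the complex is acyclic.
\<close>

section \<open>Monomials\<close>

text \<open>The incidence function is arbitrary: only its unit values on facets and the vanishing of
  double boundaries are known. A contracting homotopy with explicit signs is therefore avoided.
  Cycles are pushed off matched pairs of cells instead, which needs only that the incidence number
  of a matched pair is 1 or -1 and so works over every field.

  \<open>(a, b)\<close> is admissible for \<open>u\<close> when the 0-cell
  \<open>Cell {a} {b}\<close> has label at most \<open>u\<close>. The conditions on \<open>a\<close>
  and on \<open>b\<close> interact only if \<open>b = a + 1\<close>, when the exponent 2 is required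
  at one vertex. Replacing \<open>a\<close> by a smaller \<open>a\<^sub>0\<close> cannot create this
  interaction, because \<open>a\<^sub>0 < a < b\<close>; hence the least \<open>a\<^sub>0\<close> is
  compatible with every \<open>b\<close> that occurs.

  The cells \<open>Cell {a\<^sub>0} B\<close> left by the first matching, together with the empty
  cell, are the faces of a single simplex. This is why any vertex \<open>b\<^sub>0\<close> of it can
  serve in the second matching and why the empty cell is matched too. A nonzero cycle of positive
  rank guarantees that an admissible pair exists at all.\<close>

abbreviation lookup :: "('a \<Rightarrow>\<^sub>0 'b::zero) \<Rightarrow> 'a \<Rightarrow> 'b" where
  "lookup \<equiv> Poly_Mapping.lookup"

abbreviation single :: "'a \<Rightarrow> 'b::zero \<Rightarrow> ('a \<Rightarrow>\<^sub>0 'b)" where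
  "single \<equiv> Poly_Mapping.single"

definition exponent :: "('n::finite \<Rightarrow> nat) \<Rightarrow> ('n \<Rightarrow>\<^sub>0 nat)" where
  "exponent a = Abs_poly_mapping a"

lemma lookup_exponent [simp]: "lookup (exponent a) = a"
  unfolding exponent_def by (rule lookup_Abs_poly_mapping) simp

lemma exponent_lookup [simp]: "exponent (lookup t) = t"
  by (rule poly_mapping_eqI) simp

lemma exponent_eq_iff [simp]: "exponent a = exponent b \<longleftrightarrow> a = b"
  by (metis lookup_exponent)

lemma indet_power: "indet i ^ k = (single (single i k) 1 :: ('n, 'k::field) mpoly)"
proof (induction k)
  case (Suc k)
  have "indet i ^ Suc k = (single (single i 1 + single i k) (1 * 1) :: ('n, 'k) mpoly)"
    unfolding power_Suc Suc.IH by (simp add: indet_def mult_single)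
  also have "single i 1 + single i k = (single i (Suc k) :: 'n \<Rightarrow>\<^sub>0 nat)"
    by (simp flip: single_add)
  finally show ?case by simp
qed simp

lemma monom_eq_single: "monom a = (single (exponent a) 1 :: ('n::finite, 'k::field) mpoly)"
proof -
  have "(\<Prod>i\<in>A. indet i ^ a i) = (single (\<Sum>i\<in>A. single i (a i)) 1 :: ('n, 'k) mpoly)"
    if "finite A" for A
    using that by induction (simp_all add: indet_power mult_single)
  moreover have "(\<Sum>i\<in>UNIV. single i (a i)) = exponent a"
    by (rule poly_mapping_eqI) (simp add: lookup_sum lookup_single when_def)
  ultimately show ?thesis
    by (simp add: monom_def)
qed

lemma Sum_any_when_conj_eq: "Sum_any (\<lambda>l. f l when (P \<and> l = c)) = (if P then f c else 0)"
  by (cases P) (simp_all add: when_def)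

text \<open>Multiplication by a monomial only shifts exponents. This is how a matrix entry of the
  differential becomes a scalar once the multidegree is fixed.\<close>

lemma lookup_times_monom:
  fixes p :: "('n::finite, 'k::field) mpoly"
  shows "lookup (p * monom a) (exponent t) =
    (if \<forall>i. a i \<le> t i then lookup p (exponent (\<lambda>i. t i - a i)) else 0)"
proof -
  have eq: "(exponent t = l + exponent a) \<longleftrightarrow>
      ((\<forall>i. a i \<le> t i) \<and> l = exponent (\<lambda>i. t i - a i))" for l
  proof
    assume "exponent t = l + exponent a"
    then have "t i = lookup l i + a i" for i
      by (metis lookup_add lookup_exponent)
    then show "(\<forall>i. a i \<le> t i) \<and> l = exponent (\<lambda>i. t i - a i)"
      by (simp add: poly_mapping_eq_iff)
  next
    assume "(\<forall>i. a i \<le> t i) \<and> l = exponent (\<lambda>i. t i - a i)"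
    then show "exponent t = l + exponent a"
      by (auto intro!: poly_mapping_eqI simp: lookup_add)
  qed
  have "lookup (p * monom a) (exponent t) = Sum_any (\<lambda>l. lookup p l when exponent t = l + exponent a)"
  proof -
    have "Sum_any (\<lambda>q. lookup (single (exponent a) (1::'k)) q when exponent t = l + q) =
        Sum_any (\<lambda>q. (1 when exponent t = l + exponent a) when exponent a = q)" for l
      by (intro Sum_any.cong) (auto simp: lookup_single when_def)
    then show ?thesis
      by (simp add: lookup_mult monom_eq_single mult_when)
  qed
  also have "\<dots> = Sum_any (\<lambda>l. lookup p l when ((\<forall>i. a i \<le> t i) \<and> l = exponent (\<lambda>i. t i - a i)))"
    by (simp only: eq)
  also have "\<dots> =
    (if \<forall>i. a i \<le> t i then lookup p (exponent (\<lambda>i. t i - a i)) else 0)"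
    by (rule Sum_any_when_conj_eq)
  finally show ?thesis .
qed

lemma monom_in_ideal_indet:
  assumes "0 < a i"
  shows "monom a \<in> ideal_gen (range (indet :: 'n::finite \<Rightarrow> ('n, 'k::field) mpoly))"
proof -
  have "monom a = indet i ^ a i * (\<Prod>j\<in>UNIV - {i}. indet j ^ a j :: ('n, 'k) mpoly)"
    by (simp add: monom_def prod.remove[of UNIV i])
  also have "indet i ^ a i = indet i ^ (a i - 1) * (indet i :: ('n, 'k) mpoly)"
    using assms by (metis Suc_diff_1 power_Suc2)
  finally have "monom a = (indet i ^ (a i - 1) * (\<Prod>j\<in>UNIV - {i}. indet j ^ a j)) * (indet i :: ('n, 'k) mpoly)"
    by (simp only: mult_ac)
  then show ?thesis
    unfolding ideal_gen_def
    by (simp only: module.span_scale[OF module_times] module.span_base[OF module_times] rangeI)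
qed

lemma of_int_times_lookup: "lookup (of_int c * p) t = of_int c * lookup (p :: ('n, 'k::field) mpoly) t"
proof -
  have "of_int c * p = Poly_Mapping.map ((*) (of_int c)) p"
    by (simp add: mult_map_scale_conv_mult)
  then show ?thesis
    by (simp add: Poly_Mapping.map.rep_eq when_def)
qed

lemma lookup_scale: "lookup (scale r f) b = r * lookup f b"
  by (simp add: scale_def Poly_Mapping.map.rep_eq when_def)


section \<open>Chain complexes given by incidence numbers\<close>

text \<open>\<open>rank\<close> plays the role of dimension plus one, so that it agrees with the
  homological degree and the empty cell can have rank 0. The sum in \<open>incidence_sum\<close> may
  run over all of \<open>X\<close>, as pairs with incidence number 0 contribute nothing.\<close>

locale cell_complex =
  fixes X :: "'c set" and rank :: "'c \<Rightarrow> nat" and \<epsilon> :: "'c \<Rightarrow> 'c \<Rightarrow> int"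
  assumes finite_cells: "finite X"
    and incidence_values: "B \<in> X \<Longrightarrow> B' \<in> X \<Longrightarrow> \<epsilon> B B' \<in> {0, 1, -1}"
    and incidence_rank: "B \<in> X \<Longrightarrow> B' \<in> X \<Longrightarrow> \<epsilon> B B' \<noteq> 0 \<Longrightarrow> rank B = Suc (rank B')"
    and incidence_sum: "B \<in> X \<Longrightarrow> B'' \<in> X \<Longrightarrow> (\<Sum>B'\<in>X. \<epsilon> B B' * \<epsilon> B' B'') = 0"
begin

definition boundary :: "('c \<Rightarrow> 'k::field) \<Rightarrow> 'c \<Rightarrow> 'k" where
  "boundary f B' = (\<Sum>B\<in>X. of_int (\<epsilon> B B') * f B)"

lemma boundary_add: "boundary (\<lambda>B. f B + g B) B' = boundary f B' + boundary g B'"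
  by (simp add: boundary_def sum.distrib distrib_left)

lemma boundary_diff: "boundary (\<lambda>B. f B - g B) B' = boundary f B' - boundary g B'"
  by (simp add: boundary_def sum_subtractf right_diff_distrib)

lemma boundary_boundary:
  assumes "B'' \<in> X"
  shows "boundary (boundary f) B'' = (0 :: 'k::field)"
proof -
  have "boundary (boundary f) B'' = (\<Sum>B'\<in>X. \<Sum>B\<in>X. of_int (\<epsilon> B' B'') * (of_int (\<epsilon> B B') * f B))"
    by (simp add: boundary_def sum_distrib_left)
  also have "\<dots> = (\<Sum>B\<in>X. \<Sum>B'\<in>X. of_int (\<epsilon> B' B'') * (of_int (\<epsilon> B B') * f B))"
    by (rule sum.swap)
  also have "\<dots> = (\<Sum>B\<in>X. f B * of_int (\<Sum>B'\<in>X. \<epsilon> B B' * \<epsilon> B' B''))"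
    by (simp add: sum_distrib_left mult_ac)
  also have "\<dots> = 0"
    using incidence_sum[OF _ assms] by simp
  finally show ?thesis .
qed

definition chain :: "'c set \<Rightarrow> nat \<Rightarrow> ('c \<Rightarrow> 'k::field) \<Rightarrow> bool" where
  "chain S r f \<longleftrightarrow> (\<forall>B. f B \<noteq> 0 \<longrightarrow> B \<in> S \<and> rank B = r)"

definition cycle :: "('c \<Rightarrow> 'k::field) \<Rightarrow> bool" where
  "cycle f \<longleftrightarrow> (\<forall>B\<in>X. boundary f B = 0)"

text \<open>
  One step of algebraic discrete Morse theory: matching the cells of \<open>D\<close> with cofaces \<open>M c\<close> that are
  their only cofaces outside \<open>D\<close>, the cells of \<open>D\<close> and \<open>M ` D\<close> can be removed from a cycle.
\<close>

lemma matching_reduction: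
  fixes f :: "'c \<Rightarrow> 'k::field"
  assumes S: "S \<subseteq> X" "D \<subseteq> S" "M ` D \<subseteq> S - D"
    and closed: "\<And>B B'. B \<in> S \<Longrightarrow> B' \<in> X \<Longrightarrow> \<epsilon> B B' \<noteq> 0 \<Longrightarrow> B' \<in> S"
    and matched: "\<And>c. c \<in> D \<Longrightarrow> \<epsilon> (M c) c \<noteq> 0"
    and inj: "inj_on M D"
    and unique: "\<And>c B. c \<in> D \<Longrightarrow> B \<in> S - D \<Longrightarrow> \<epsilon> B c \<noteq> 0 \<Longrightarrow> B = M c"
    and f: "chain S r f" "cycle f"
  obtains g f' where "chain S (Suc r) g" "chain (S - D - M ` D) r f'" "cycle f'"
    "\<And>B. B \<in> X \<Longrightarrow> f B = boundary g B + f' B"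
proof -
  \<comment> \<open>Incidence numbers of matched pairs are 1 or -1, hence their own inverses in
    every field.\<close>
  have unit: "of_int (\<epsilon> (M c) c) * of_int (\<epsilon> (M c) c) = (1::'k)" if "c \<in> D" for c
  proof -
    have "M c \<in> X" "c \<in> X"
      using that S by auto
    then have "\<epsilon> (M c) c \<in> {1, -1}"
      using incidence_values[of "M c" c] matched[OF that] by auto
    then show ?thesis by auto
  qed
  have only: "(\<Sum>B\<in>X. of_int (\<epsilon> B c) * h B) = (of_int (\<epsilon> (M c) c) * h (M c) :: 'k)"
    if "c \<in> D" "\<And>B. h B \<noteq> 0 \<Longrightarrow> B \<in> S - D" for c h
  proof -
    have "(\<Sum>B\<in>X. of_int (\<epsilon> B c) * h B) = (\<Sum>B\<in>{M c}. of_int (\<epsilon> B c) * h B)"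
    proof (rule sum.mono_neutral_right)
      show "finite X" by (rule finite_cells)
      show "{M c} \<subseteq> X" using that S by auto
      show "\<forall>i\<in>X - {M c}. of_int (\<epsilon> i c) * h i = 0"
        using unique[OF that(1)] that(2) by force
    qed
    then show ?thesis by simp
  qed
  \<comment> \<open>The chain on the matched cofaces whose boundary agrees with \<open>f\<close> on
    \<open>D\<close>: multiplying by the incidence number is the same as dividing by it.\<close>
  define g where "g B = (if B \<in> M ` D then of_int (\<epsilon> B (inv_into D M B)) * f (inv_into D M B) else 0)" for B
  have g_M: "g (M c) = of_int (\<epsilon> (M c) c) * f c" if "c \<in> D" for c
    using that inj by (simp add: g_def)
  have g_supp: "B \<in> S - D" if "g B \<noteq> 0" for B
    using that S by (auto simp: g_def split: if_splits)
  have chain_g: "chain S (Suc r) g"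
    unfolding chain_def
  proof (intro allI impI)
    fix B assume B: "g B \<noteq> 0"
    then obtain c where c: "c \<in> D" "B = M c"
      by (auto simp: g_def split: if_splits)
    then have "f c \<noteq> 0" using B g_M by auto
    then have "rank c = r" using f(1) by (simp add: chain_def)
    moreover have "M c \<in> X" "c \<in> X" using c S by auto
    ultimately show "B \<in> S \<and> rank B = Suc r"
      using incidence_rank matched c g_supp[OF B] by auto
  qed
  \<comment> \<open>Cut off outside \<open>X\<close>, where nothing is known about
    \<open>\<epsilon>\<close>.\<close>
  define f' where "f' B = (if B \<in> X then f B - boundary g B else 0)" for B
  have f'_D: "f' c = 0" if "c \<in> D" for c
  proof -
    have "boundary g c = of_int (\<epsilon> (M c) c) * g (M c)"
      unfolding boundary_def using that g_supp by (rule only)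
    also have "\<dots> = f c"
      using unit[OF that] by (simp add: g_M[OF that] flip: mult.assoc)
    finally show ?thesis by (simp add: f'_def)
  qed
  have chain_f': "chain S r f'"
    unfolding chain_def
  proof (intro allI impI)
    fix B assume B: "f' B \<noteq> 0"
    then have BX: "B \<in> X" by (simp add: f'_def split: if_splits)
    consider "f B \<noteq> 0" | "boundary g B \<noteq> 0"
      using B BX by (cases "f B = 0") (auto simp: f'_def)
    then show "B \<in> S \<and> rank B = r"
    proof cases
      case 1 then show ?thesis using f(1) by (simp add: chain_def)
    next
      case 2
      then obtain C where C: "C \<in> X" "of_int (\<epsilon> C B) * g C \<noteq> 0"
        unfolding boundary_def by (rule sum.not_neutral_contains_not_neutral)
      then have \<epsilon>: "\<epsilon> C B \<noteq> 0" and "g C \<noteq> 0" by auto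
      then have "C \<in> S" "rank C = Suc r" using chain_g by (simp_all add: chain_def)
      then show ?thesis using closed[OF _ BX \<epsilon>] incidence_rank[OF C(1) BX \<epsilon>] by simp
    qed
  qed
  have cycle_f': "cycle f'"
    unfolding cycle_def
  proof
    fix B assume B: "B \<in> X"
    have "boundary f' B = boundary (\<lambda>B. f B - boundary g B) B"
      unfolding boundary_def by (intro sum.cong) (simp_all add: f'_def boundary_def)
    then show "boundary f' B = 0"
      using f(2) B by (simp add: boundary_diff boundary_boundary cycle_def)
  qed
  \<comment> \<open>A cycle that vanishes on \<open>D\<close> vanishes on the partners as well: its
    boundary at \<open>c\<close> reduces to the term of \<open>M c\<close>, whose coefficient is a
    unit.\<close>
  have f'_M: "f' (M c) = 0" if "c \<in> D" for c
  proof -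
    have "boundary f' c = of_int (\<epsilon> (M c) c) * f' (M c)"
      unfolding boundary_def using that
      by (rule only) (use f'_D chain_f' in \<open>auto simp: chain_def\<close>)
    moreover have "boundary f' c = 0"
      using cycle_f' that S by (auto simp: cycle_def)
    ultimately show ?thesis
      using unit[OF that] by auto
  qed
  show thesis
  proof
    show "chain (S - D - M ` D) r f'"
      using chain_f' f'_D f'_M by (auto simp: chain_def)
    show "f B = boundary g B + f' B" if "B \<in> X" for B
      using that by (simp add: f'_def)
  qed fact+
qed

end


section \<open>Labelled complexes\<close>

text \<open>\<open>label_less\<close> serves twice: it gives the divisibility of labels that makes
  truncated exponents correct, and its strictness puts a nonconstant monomial into every nonzero
  matrix entry, which is minimality. \<open>incidence_bottom\<close> turns the entries of the first
  map into the generators themselves, without signs.\<close>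

locale labelled_complex = cell_complex X rank \<epsilon>
  for X :: "'c set" and rank :: "'c \<Rightarrow> nat" and \<epsilon> :: "'c \<Rightarrow> 'c \<Rightarrow> int" +
  fixes bottom :: 'c and facet :: "'c \<Rightarrow> 'c \<Rightarrow> bool" and label :: "'c \<Rightarrow> 'n::finite \<Rightarrow> nat"
  assumes bottom_in: "bottom \<in> X"
    and rank_0: "B \<in> X \<Longrightarrow> rank B = 0 \<longleftrightarrow> B = bottom"
    and label_bottom: "label bottom = (\<lambda>i. 0)"
    and facet_iff: "B \<in> X \<Longrightarrow> B' \<in> X \<Longrightarrow> facet B' B \<longleftrightarrow> \<epsilon> B B' \<noteq> 0"
    and incidence_bottom: "B \<in> X \<Longrightarrow> rank B = 1 \<Longrightarrow> \<epsilon> B bottom = 1"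
    and label_less: "B \<in> X \<Longrightarrow> B' \<in> X \<Longrightarrow> \<epsilon> B B' \<noteq> 0 \<Longrightarrow> label B' < label B"
begin

definition coefficient :: "'c \<Rightarrow> 'c \<Rightarrow> ('n, 'k::field) mpoly" where
  "coefficient B B' = of_int (\<epsilon> B B') * monom (\<lambda>i. label B i - label B' i)"

definition differential :: "('c \<Rightarrow>\<^sub>0 ('n, 'k::field) mpoly) \<Rightarrow> ('c \<Rightarrow>\<^sub>0 ('n, 'k) mpoly)" where
  "differential f = (\<Sum>B \<in> Poly_Mapping.keys f. \<Sum>B' | B' \<in> X \<and> facet B' B.
     scale (lookup f B) (single B' (of_int (\<epsilon> B B') * monom (\<lambda>i. label B i - label B' i))))"

text \<open>The basis element of \<open>B\<close> has degree \<open>label B\<close>, so the part of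
  \<open>f\<close> of multidegree \<open>u\<close> is one scalar for each \<open>B\<close>, the
  coefficient at \<open>u - label B\<close>. The case distinction prevents spurious terms from
  truncated subtraction.\<close>

definition component :: "('n \<Rightarrow> nat) \<Rightarrow> ('c \<Rightarrow>\<^sub>0 ('n, 'k::field) mpoly) \<Rightarrow> 'c \<Rightarrow> 'k" where
  "component u f B =
     (if label B \<le> u then lookup (lookup f B) (exponent (\<lambda>i. u i - label B i)) else 0)"

text \<open>The cells that contribute in multidegree \<open>u\<close>: the complex
  \<open>X_{\<le> u}\<close> of the Bayer-Sturmfels criterion.\<close>

definition subcomplex :: "('n \<Rightarrow> nat) \<Rightarrow> 'c set" where
  "subcomplex u = {B \<in> X. label B \<le> u}"

abbreviation F :: "nat \<Rightarrow> ('c \<Rightarrow>\<^sub>0 ('n, 'k::field) mpoly) set" where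
  "F i \<equiv> free_module {B \<in> X. rank B = i}"

lemma coefficient_eq_0: "\<epsilon> B B' = 0 \<Longrightarrow> coefficient B B' = 0"
  by (simp add: coefficient_def)

lemma free_module_iff: "f \<in> free_module Y \<longleftrightarrow> (\<forall>B. lookup f B \<noteq> 0 \<longrightarrow> B \<in> Y)"
  by (auto simp: free_module_def in_keys_iff)

lemma F_iff: "f \<in> F i \<longleftrightarrow> (\<forall>B. lookup f B \<noteq> 0 \<longrightarrow> B \<in> X \<and> rank B = i)"
  by (auto simp: free_module_def in_keys_iff)

lemma F_subset: "f \<in> F i \<Longrightarrow> f \<in> free_module X"
  by (auto simp: free_module_def)

section \<open>The differential as a homogeneous homomorphism with entries in the maximal
  ideal\<close>

lemma lookup_differential_raw:
  "lookup (differential f) B' =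
     (\<Sum>B\<in>Poly_Mapping.keys f. if B' \<in> X \<and> facet B' B then lookup f B * coefficient B B' else 0)"
proof -
  have "(\<Sum>C | C \<in> X \<and> facet C B. lookup (scale (lookup f B) (single C (coefficient B C))) B') =
    (if B' \<in> X \<and> facet B' B then lookup f B * coefficient B B' else 0)" for B
  proof -
    have "(\<Sum>C | C \<in> X \<and> facet C B. lookup (scale (lookup f B) (single C (coefficient B C))) B') =
        (\<Sum>C | C \<in> X \<and> facet C B. if C = B' then lookup f B * coefficient B C else 0)"
      by (intro sum.cong) (simp_all add: lookup_scale lookup_single when_def)
    then show ?thesis
      using finite_cells by simp
  qed
  then show ?thesis
    by (simp add: differential_def lookup_sum coefficient_def)
qed

lemma lookup_differential_outside: "B' \<notin> X \<Longrightarrow> lookup (differential f) B' = 0"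
  by (simp add: lookup_differential_raw)

lemma lookup_differential:
  assumes "f \<in> free_module X" "B' \<in> X"
  shows "lookup (differential f) B' = (\<Sum>B\<in>X. lookup f B * coefficient B B')"
proof -
  have keys: "Poly_Mapping.keys f \<subseteq> X"
    using assms by (simp add: free_module_def)
  have "lookup (differential f) B' = (\<Sum>B\<in>Poly_Mapping.keys f. lookup f B * coefficient B B')"
    unfolding lookup_differential_raw
    using keys assms by (intro sum.cong) (auto simp: facet_iff coefficient_eq_0)
  also have "\<dots> = (\<Sum>B\<in>X. lookup f B * coefficient B B')"
    using keys finite_cells by (intro sum.mono_neutral_left) (auto simp: in_keys_iff)
  finally show ?thesis .
qed

lemma differential_in_F:
  assumes "f \<in> F (Suc i)"
  shows "differential f \<in> F i"
  unfolding F_iff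
proof (intro allI impI)
  fix B' assume nz: "lookup (differential f) B' \<noteq> 0"
  then have B': "B' \<in> X" using lookup_differential_outside by blast
  with nz obtain B where "B \<in> X" "lookup f B * coefficient B B' \<noteq> 0"
    unfolding lookup_differential[OF F_subset[OF assms] B']
    by (elim sum.not_neutral_contains_not_neutral)
  then have "B \<in> X" "lookup f B \<noteq> 0" "\<epsilon> B B' \<noteq> 0"
    by (auto simp: coefficient_eq_0)
  with assms B' show "B' \<in> X \<and> rank B' = i"
    by (metis F_iff Suc_inject incidence_rank)
qed

lemma differential_eqI:
  assumes "f \<in> free_module X"
    and "\<And>B'. B' \<in> X \<Longrightarrow> lookup h B' = (\<Sum>B\<in>X. lookup f B * coefficient B B')"
    and "\<And>B'. B' \<notin> X \<Longrightarrow> lookup h B' = 0"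
  shows "differential f = h"
proof (rule poly_mapping_eqI)
  fix B'
  show "lookup (differential f) B' = lookup h B'"
    by (cases "B' \<in> X") (simp_all add: assms lookup_differential lookup_differential_outside)
qed

lemma differential_add:
  assumes "f \<in> free_module X" "g \<in> free_module X"
  shows "differential (f + g) = differential f + differential g"
proof (rule differential_eqI)
  show "f + g \<in> free_module X"
    using assms Poly_Mapping.keys_add[of f g] by (auto simp: free_module_def)
qed (simp_all add: lookup_add lookup_differential_outside lookup_differential assms
      sum.distrib distrib_right)

lemma differential_scale:
  assumes "f \<in> free_module X"
  shows "differential (scale r f) = scale r (differential f)"
proof (rule differential_eqI)
  show "scale r f \<in> free_module X"
    using assms unfolding free_module_iff lookup_scale by (metis mult_zero_right)
qed (simp_all add: lookup_scale lookup_differential_outside lookup_differential assms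
      sum_distrib_left mult.assoc)

lemma lookup_differential_single:
  assumes "B \<in> X" "B' \<in> X"
  shows "lookup (differential (single B 1)) B' = coefficient B B'"
proof -
  have "single B 1 \<in> free_module X"
    using assms by (auto simp: free_module_def)
  then have "lookup (differential (single B 1)) B' = (\<Sum>C\<in>X. if C = B then coefficient C B' else 0)"
    by (subst lookup_differential) (auto simp: assms lookup_single when_def intro!: sum.cong)
  then show ?thesis
    using assms finite_cells by simp
qed

lemma homogeneous_coefficient:
  assumes "B \<in> X" "B' \<in> X"
  shows "homogeneous (\<lambda>j. int (label B j) - int (label B' j)) (coefficient B B' :: ('n, 'k::field) mpoly)"
proof (cases "\<epsilon> B B' = 0")
  case True
  then show ?thesis by (simp add: homogeneous_def coefficient_eq_0)
next
  case False
  then have le: "label B' j \<le> label B j" for j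
    using label_less[OF assms] by (simp add: less_le le_fun_def)
  have "t = exponent (\<lambda>i. label B i - label B' i)"
    if "t \<in> Poly_Mapping.keys (coefficient B B' :: ('n, 'k) mpoly)" for t
    using that by (auto simp: coefficient_def in_keys_iff of_int_times_lookup monom_eq_single lookup_single when_def
        split: if_splits)
  then show ?thesis
    using le by (fastforce simp: homogeneous_def)
qed

lemma coefficient_in_ideal_indet:
  assumes "B \<in> X" "B' \<in> X"
  shows "coefficient B B' \<in> ideal_gen (range (indet :: 'n \<Rightarrow> ('n, 'k::field) mpoly))"
proof (cases "\<epsilon> B B' = 0")
  case True
  then show ?thesis
    unfolding ideal_gen_def by (simp add: coefficient_eq_0 module.span_zero[OF module_times])
next
  case False
  then obtain i where "label B' i < label B i"
    using label_less[OF assms] unfolding less_le_not_le le_fun_def by (meson not_le)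
  then have "monom (\<lambda>i. label B i - label B' i) \<in> ideal_gen (range (indet :: 'n \<Rightarrow> ('n, 'k) mpoly))"
    by (intro monom_in_ideal_indet[of _ i]) simp
  then show ?thesis
    unfolding ideal_gen_def coefficient_def by (rule module.span_scale[OF module_times])
qed

lemma differential_in_ideal_indet:
  assumes "f \<in> free_module X"
  shows "lookup (differential f) B' \<in> ideal_gen (range (indet :: 'n \<Rightarrow> ('n, 'k::field) mpoly))"
proof (cases "B' \<in> X")
  case True
  show ?thesis
    unfolding lookup_differential[OF assms True] ideal_gen_def
    using coefficient_in_ideal_indet[OF _ True] unfolding ideal_gen_def
    by (intro module.span_sum[OF module_times] module.span_scale[OF module_times]) auto
next
  case False
  then show ?thesis
    unfolding ideal_gen_def
    by (simp add: lookup_differential_outside module.span_zero[OF module_times])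
qed

text \<open>The matrix entry shifts the exponent \<open>u - label B'\<close> to
  \<open>u - label B\<close> and leaves an integer factor. Where the incidence number is nonzero,
  failure of \<open>label B' \<le> u\<close> implies failure of \<open>label B \<le> u\<close>, so
  both sides of the summand vanish.\<close>

lemma component_differential:
  fixes f :: "'c \<Rightarrow>\<^sub>0 ('n, 'k::field) mpoly"
  assumes "f \<in> free_module X" "B' \<in> X"
  shows "component u (differential f) B' = boundary (component u f) B'"
proof -
  have summand: "(if label B' \<le> u then lookup (lookup f B * coefficient B B') (exponent (\<lambda>i. u i - label B' i)) else 0)
      = of_int (\<epsilon> B B') * component u f B" if "B \<in> X" for B
  proof (cases "\<epsilon> B B' = 0")
    case False
    then have le: "label B' i \<le> label B i" for i
      using label_less[OF that assms(2)] by (simp add: less_le le_fun_def)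
    show ?thesis
    proof (cases "label B' \<le> u")
      case True
      then have u: "label B' i \<le> u i" for i by (simp add: le_fun_def)
      have iff: "(label B i - label B' i \<le> u i - label B' i) = (label B i \<le> u i)"
        and eq: "u i - label B' i - (label B i - label B' i) = u i - label B i" for i
        using le[of i] u[of i] by auto
      have "lookup (lookup f B * coefficient B B') (exponent (\<lambda>i. u i - label B' i)) =
          of_int (\<epsilon> B B') * lookup (lookup f B * monom (\<lambda>i. label B i - label B' i)) (exponent (\<lambda>i. u i - label B' i))"
        unfolding coefficient_def by (simp only: mult.left_commute[of "lookup f B"] of_int_times_lookup)
      also have "\<dots> = of_int (\<epsilon> B B') * component u f B"
        by (simp only: lookup_times_monom iff eq component_def le_fun_def)
      finally show ?thesis using True by simp
    next
      case False
      then have "\<not> label B \<le> u"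
        using order_trans[OF less_imp_le[OF label_less[OF that assms(2)]]] \<open>\<epsilon> B B' \<noteq> 0\<close> by blast
      with False show ?thesis by (simp add: component_def)
    qed
  qed (simp add: coefficient_eq_0)
  have "component u (differential f) B' =
      (\<Sum>B\<in>X. if label B' \<le> u then lookup (lookup f B * coefficient B B') (exponent (\<lambda>i. u i - label B' i)) else 0)"
    by (simp add: component_def lookup_differential assms lookup_sum)
  also have "\<dots> = (\<Sum>B\<in>X. of_int (\<epsilon> B B') * component u f B)"
    by (intro sum.cong refl summand)
  finally show ?thesis
    by (simp add: boundary_def)
qed

lemma lookup_eq_component: "lookup (lookup f B) t = component (\<lambda>i. label B i + lookup t i) f B"
  by (simp add: component_def le_fun_def)

lemma eq_if_components_eq:
  assumes "f \<in> free_module X" "g \<in> free_module X"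
    and "\<And>u B. B \<in> X \<Longrightarrow> component u f B = component u g B"
  shows "f = g"
proof (rule poly_mapping_eqI)
  fix B
  show "lookup f B = lookup g B"
  proof (cases "B \<in> X")
    case True
    then show ?thesis
      by (intro poly_mapping_eqI) (simp add: lookup_eq_component assms(3))
  next
    case False
    then have "B \<notin> Poly_Mapping.keys f" "B \<notin> Poly_Mapping.keys g"
      using assms(1,2) by (auto simp: free_module_def)
    then show ?thesis by (simp add: in_keys_iff)
  qed
qed

lemma component_zero: "component u 0 B = 0"
  by (simp add: component_def)

text \<open>Finiteness allows preimages chosen separately in each multidegree to be summed to
  polynomials.\<close>

lemma finite_component_support:
  "finite {u. \<exists>B\<in>X. component u f B \<noteq> 0}"
proof -
  have "{u. \<exists>B\<in>X. component u f B \<noteq> 0} \<subseteq>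
      (\<Union>B\<in>X. (\<lambda>t i. label B i + lookup t i) ` Poly_Mapping.keys (lookup f B))"
  proof safe
    fix u B assume B: "B \<in> X" "component u f B \<noteq> 0"
    then have le: "label B i \<le> u i" for i
      by (simp add: component_def le_fun_def split: if_splits)
    have "exponent (\<lambda>i. u i - label B i) \<in> Poly_Mapping.keys (lookup f B)"
      using B by (auto simp: component_def in_keys_iff split: if_splits)
    moreover have "u = (\<lambda>i. label B i + lookup (exponent (\<lambda>i. u i - label B i)) i)"
      using le by (simp add: fun_eq_iff)
    ultimately show "u \<in> (\<Union>B\<in>X. (\<lambda>t i. label B i + lookup t i) ` Poly_Mapping.keys (lookup f B))"
      using B(1) by blast
  qed
  then show ?thesis
    by (rule finite_subset) (simp add: finite_cells)
qed

text \<open>The reverse of taking components: scalar chains may be prescribed independently in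
  finitely many multidegrees. A nonzero \<open>h u B\<close> forces \<open>label B \<le> u\<close>,
  so the truncated difference \<open>u - label B\<close> determines \<open>u\<close> and
  contributions of different degrees never collide.\<close>

lemma obtain_components:
  assumes "finite U" and chain: "\<And>u. u \<in> U \<Longrightarrow> chain (subcomplex u) r (h u)"
  obtains g :: "'c \<Rightarrow>\<^sub>0 ('n, 'k::field) mpoly"
  where "g \<in> F r" "\<And>u B. component u g B = (if u \<in> U then h u B else 0)"
proof
  define p where "p B = (\<Sum>u\<in>U. single (exponent (\<lambda>i. u i - label B i)) (h u B))" for B
  define g where "g = (\<Sum>B | B \<in> X \<and> rank B = r. single B (p B))"
  have p_0: "p B = 0" if "\<not> (B \<in> X \<and> rank B = r)" for B
    unfolding p_def
  proof (intro sum.neutral ballI)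
    fix u assume "u \<in> U"
    then have "h u B = 0"
      using that chain[of u] by (auto simp: chain_def subcomplex_def)
    then show "single (exponent (\<lambda>i. u i - label B i)) (h u B) = 0" by simp
  qed
  have lookup_g: "lookup g B = p B" for B
    using p_0[of B] finite_cells by (simp add: g_def lookup_sum lookup_single when_def)
  show "g \<in> F r"
    using p_0 by (auto simp: F_iff lookup_g)
  show "component u g B = (if u \<in> U then h u B else 0)" for u B
  proof (cases "label B \<le> u")
    case True
    have "(h u' B when exponent (\<lambda>i. u' i - label B i) = exponent (\<lambda>i. u i - label B i)) =
        (if u' = u then h u B else 0)" if "u' \<in> U" for u'
    proof (cases "h u' B = 0")
      case True
      then show ?thesis by auto
    next
      case False
      then have "label B \<le> u'"
        using chain[OF that] by (auto simp: chain_def subcomplex_def)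
      then have "exponent (\<lambda>i. u' i - label B i) = exponent (\<lambda>i. u i - label B i) \<longleftrightarrow> u' = u"
        using True by (simp add: le_fun_def fun_eq_iff eq_diff_iff)
      then show ?thesis by (simp add: when_def)
    qed
    then have "(\<Sum>u'\<in>U. h u' B when exponent (\<lambda>i. u' i - label B i) = exponent (\<lambda>i. u i - label B i)) =
        (\<Sum>u'\<in>U. if u' = u then h u B else 0)"
      by (intro sum.cong refl)
    then show ?thesis
      using True assms(1)
      by (simp add: component_def lookup_g p_def lookup_sum lookup_single del: exponent_eq_iff)
  next
    case False
    then have "h u B = 0" if "u \<in> U"
      using chain[OF that] by (auto simp: chain_def subcomplex_def)
    then show ?thesis
      using False by (simp add: component_def)
  qed
qed

lemma chain_component:
  assumes "f \<in> F r"
  shows "chain (subcomplex u) r (component u f)"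
  using assms by (auto simp: chain_def subcomplex_def component_def F_iff split: if_splits) (metis lookup_zero)+

lemma cycle_component:
  assumes "f \<in> free_module X" "differential f = 0"
  shows "cycle (component u f)"
  using assms by (simp add: cycle_def component_zero flip: component_differential)

text \<open>\<open>F 0\<close> is free on the bottom cell, and the map from \<open>F 1\<close> to it
  is the row of monomials \<open>label B\<close>, since \<open>bottom\<close> has label 1 and the
  incidence numbers there are 1. Its image is the span of these monomials.\<close>

lemma image_augmentation:
  "differential ` F 1 =
    {f \<in> F 0. lookup f bottom \<in>
      (ideal_gen {monom (label B) | B. B \<in> X \<and> rank B = 1} :: ('n, 'k::field) mpoly set)}"
    (is "_ = {f \<in> F 0. _ \<in> ideal_gen ?S}")
proof -
  define V where "V = {B \<in> X. rank B = 1}"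
  have V: "finite V" "V \<subseteq> X"
    using finite_cells by (auto simp: V_def)
  have S: "?S = (\<lambda>B. monom (label B)) ` V"
    by (auto simp: V_def)
  have coeff: "coefficient B bottom = monom (label B)" if "B \<in> V" for B
    using that incidence_bottom[of B] by (simp add: V_def coefficient_def label_bottom)
  have eval_bottom: "lookup (differential f) bottom = (\<Sum>B\<in>V. lookup f B * monom (label B))"
    if "f \<in> F 1" for f :: "'c \<Rightarrow>\<^sub>0 ('n, 'k) mpoly"
  proof -
    have "(\<Sum>B\<in>V. lookup f B * monom (label B)) = (\<Sum>B\<in>V. lookup f B * coefficient B bottom)"
      by (intro sum.cong) (simp_all add: coeff)
    also have "\<dots> = (\<Sum>B\<in>X. lookup f B * coefficient B bottom)"
    proof (intro sum.mono_neutral_left ballI)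
      fix B assume "B \<in> X - V"
      then have "lookup f B = 0"
        using that unfolding F_iff V_def by blast
      then show "lookup f B * coefficient B bottom = 0" by simp
    qed (use V finite_cells in auto)
    finally show ?thesis
      using F_subset[OF that] by (simp add: lookup_differential bottom_in)
  qed
  show ?thesis
  proof (intro equalityI subsetI)
    fix g assume "g \<in> differential ` (F 1 :: ('c \<Rightarrow>\<^sub>0 ('n, 'k) mpoly) set)"
    then obtain f where f: "f \<in> F 1" "g = differential f" by blast
    have "lookup g bottom \<in> ideal_gen ?S"
      unfolding f(2) eval_bottom[OF f(1)] S ideal_gen_def
      by (intro module.span_sum[OF module_times] module.span_scale[OF module_times]
          module.span_base[OF module_times]) simp
    then show "g \<in> {f \<in> F 0. lookup f bottom \<in> ideal_gen ?S}"
      using differential_in_F[of f 0] f by simp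
  next
    fix g :: "'c \<Rightarrow>\<^sub>0 ('n, 'k) mpoly"
    assume g: "g \<in> {f \<in> F 0. lookup f bottom \<in> ideal_gen ?S}"
    have "\<exists>c. lookup g bottom = (\<Sum>B\<in>V. c B * monom (label B))"
    proof -
      have "lookup g bottom \<in> module.span (*) ((\<lambda>B. monom (label B)) ` V)"
        using g by (simp only: S ideal_gen_def mem_Collect_eq)
      then show ?thesis
      proof (rule module.span_induct_alt[OF module_times])
        show "\<exists>c. 0 = (\<Sum>B\<in>V. c B * monom (label B) :: ('n, 'k) mpoly)"
          by (rule exI[of _ "\<lambda>B. 0"]) simp
        fix r m y :: "('n, 'k) mpoly"
        assume "m \<in> (\<lambda>B. monom (label B)) ` V" "\<exists>c. y = (\<Sum>B\<in>V. c B * monom (label B))"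
        then obtain C c where C: "C \<in> V" "m = monom (label C)"
          and y: "y = (\<Sum>B\<in>V. c B * monom (label B))" by blast
        have "r * m = (\<Sum>B\<in>V. (if B = C then r else 0) * monom (label B))"
          using C V by (simp add: if_distrib[of "\<lambda>x. x * _"] cong: if_cong)
        then have "r * m + y = (\<Sum>B\<in>V. ((if B = C then r else 0) + c B) * monom (label B))"
          by (simp only: y distrib_right sum.distrib)
        then show "\<exists>c. r * m + y = (\<Sum>B\<in>V. c B * monom (label B))"
          by (intro exI[of _ "\<lambda>B. (if B = C then r else 0) + c B"])
      qed
    qed
    then obtain c where c: "lookup g bottom = (\<Sum>B\<in>V. c B * monom (label B))" by blast
    define f where "f = (\<Sum>B\<in>V. single B (c B))"
    have lookup_f: "lookup f B = (if B \<in> V then c B else 0)" for B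
      using V by (simp add: f_def lookup_sum lookup_single when_def)
    then have f: "f \<in> F 1"
      by (auto simp: F_iff V_def split: if_splits)
    have "differential f = g"
    proof (rule poly_mapping_eqI)
      fix B
      show "lookup (differential f) B = lookup g B"
      proof (cases "B = bottom")
        case True
        then show ?thesis
          using f V by (simp add: eval_bottom c lookup_f)
      next
        case False
        then have "lookup h B = 0" if "h \<in> F 0" for h :: "'c \<Rightarrow>\<^sub>0 ('n, 'k) mpoly"
          using that rank_0 by (auto simp: F_iff)
        then show ?thesis
          using differential_in_F[of f 0] f g by simp
      qed
    qed
    then show "g \<in> differential ` F 1"
      using f by blast
  qed
qed

text \<open>Exactness is tested one multidegree at a time, where it becomes acyclicity of
  \<open>subcomplex u\<close> over the field. The hypothesis starts at rank \<open>Suc r\<close>: in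
  rank 0 the homology is the quotient ring, which the augmentation takes care of.\<close>

theorem minimal_resolution:
  assumes acyclic: "\<And>u r (f :: 'c \<Rightarrow> 'k::field). chain (subcomplex u) (Suc r) f \<Longrightarrow> cycle f \<Longrightarrow>
    \<exists>g. chain (subcomplex u) (Suc (Suc r)) g \<and> (\<forall>B\<in>X. boundary g B = f B)"
  shows "minimal_free_resolution (\<lambda>i. {B \<in> X. rank B = i}) label differential (\<lambda>f. lookup f bottom)
    (ideal_gen {monom (label B) | B. B \<in> X \<and> rank B = 1} :: ('n, 'k) mpoly set)"
proof -
  have exact: "differential ` F (i + 2) = {f \<in> F (i + 1). differential f = (0 :: 'c \<Rightarrow>\<^sub>0 ('n, 'k) mpoly)}" for i
  proof (intro equalityI subsetI)
    fix h :: "'c \<Rightarrow>\<^sub>0 ('n, 'k) mpoly"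
    assume "h \<in> differential ` F (i + 2)"
    then obtain g where g: "g \<in> F (i + 2)" "h = differential g" by blast
    have h: "h \<in> F (i + 1)"
      using differential_in_F[of g "i + 1"] g by simp
    have "differential h = 0"
    proof (rule eq_if_components_eq)
      show "differential h \<in> free_module X"
        using h differential_in_F[of h i] F_subset by auto
      show "0 \<in> free_module X" by (simp add: free_module_def)
      fix u B assume B: "B \<in> X"
      have "component u (differential h) B = boundary (component u h) B"
        using h B by (simp add: component_differential F_subset)
      also have "\<dots> = boundary (boundary (component u g)) B"
        unfolding boundary_def[of "component u h"] boundary_def[of "boundary _"]
        using F_subset[OF g(1)] by (intro sum.cong refl) (simp add: component_differential g(2))
      finally show "component u (differential h) B = component u 0 B"
        using B by (simp add: boundary_boundary component_zero)
    qed
    with h show "h \<in> {f \<in> F (i + 1). differential f = 0}" by simp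
  next
    fix f :: "'c \<Rightarrow>\<^sub>0 ('n, 'k) mpoly"
    assume "f \<in> {f \<in> F (i + 1). differential f = 0}"
    then have f: "f \<in> F (Suc i)" "differential f = 0" by auto
    \<comment> \<open>Outside \<open>U\<close> the component of \<open>f\<close> is zero and has the
      preimage zero, so finitely many chosen preimages suffice.\<close>
    define U where "U = {u. \<exists>B\<in>X. component u f B \<noteq> 0}"
    have "\<forall>u. \<exists>g. chain (subcomplex u) (Suc (Suc i)) g \<and> (\<forall>B\<in>X. boundary g B = component u f B)"
      using acyclic chain_component[OF f(1)] cycle_component[OF F_subset[OF f(1)] f(2)] by blast
    then obtain h where h: "\<And>u. chain (subcomplex u) (Suc (Suc i)) (h u)"
      "\<And>u B. B \<in> X \<Longrightarrow> boundary (h u) B = component u f B"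
      by metis
    obtain g :: "'c \<Rightarrow>\<^sub>0 ('n, 'k) mpoly" where g: "g \<in> F (Suc (Suc i))"
      "\<And>u B. component u g B = (if u \<in> U then h u B else 0)"
      by (rule obtain_components[OF finite_component_support[of f], of "Suc (Suc i)" h, folded U_def])
        (use h(1) in auto)
    have "differential g = f"
    proof (rule eq_if_components_eq)
      show "differential g \<in> free_module X" "f \<in> free_module X"
        using f(1) differential_in_F[OF g(1)] F_subset by auto
      fix u B assume B: "B \<in> X"
      have "component u (differential g) B = boundary (component u g) B"
        using g(1) B by (simp add: component_differential F_subset)
      also have "\<dots> = component u f B"
      proof (cases "u \<in> U")
        case True
        then have "component u g = h u" by (simp add: g(2) fun_eq_iff)
        then show ?thesis using h(2)[OF B] by simp
      next
        case False
        then have "boundary (component u g) B = 0" by (simp add: boundary_def g(2))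
        then show ?thesis using False B by (simp add: U_def)
      qed
      finally show "component u (differential g) B = component u f B" .
    qed
    then show "f \<in> differential ` F (i + 2)"
      using g(1) by auto
  qed
  have augmentation: "\<exists>f \<in> F 0. r - lookup f bottom \<in> ideal_gen S" for r :: "('n, 'k) mpoly" and S
  proof
    show "single bottom r \<in> F 0"
      using bottom_in rank_0 by (auto simp: F_iff lookup_single when_def)
    show "r - lookup (single bottom r) bottom \<in> ideal_gen S"
      by (simp add: ideal_gen_def module.span_zero[OF module_times])
  qed
  have degree_0: "homogeneous (\<lambda>j. int (label b j)) (lookup (single b (1 :: ('n, 'k) mpoly)) bottom)"
    if "b \<in> X" "rank b = 0" for b
    using that rank_0[of b] by (simp add: homogeneous_def label_bottom flip: single_one)
  show ?thesis
    unfolding minimal_free_resolution_def Let_def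
    using exact image_augmentation augmentation finite_cells degree_0
    by (auto simp: differential_in_F differential_add differential_scale F_subset lookup_add lookup_scale
        lookup_differential_single homogeneous_coefficient differential_in_ideal_indet)
qed

end


section \<open>Coordinates on the cycle\<close>

locale parcycle_setting =
  fixes n :: nat and v :: "nat \<Rightarrow> 'n::finite" and P :: "'n set set"
  assumes parcycle: "parcycle n v P"
begin

text \<open>
  The vertices numbered cyclically, so that for \<open>j \<in> {1..n}\<close> the \<open>j\<close>-th edge joins
  \<open>w (j - 1)\<close> to \<open>w j\<close>.
\<close>

definition w :: "nat \<Rightarrow> 'n" where
  "w i = (if i = 0 then v n else v i)"

definition relevant :: "nat set" where
  "relevant = {j \<in> {1..n}. relevant_edge (cycle_edges n v) P (w (j - 1)) (w j)}"

definition jump :: "real ^ 'n \<Rightarrow> nat \<Rightarrow> real" where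
  "jump p j = p $ w j - p $ w (j - 1)"

definition total :: "real ^ 'n \<Rightarrow> real" where
  "total p = (\<Sum>i = 1..n - 1. p $ w i)"

text \<open>The linear space parallel to the affine space \<open>U\<close>.\<close>

definition directions :: "(real ^ 'n) set" where
  "directions = {d. d $ w n = 0 \<and> total d = 0 \<and> (\<forall>j\<in>{1..n} - relevant. jump d j = 0)}"

abbreviation U :: "(real ^ 'n) set" where
  "U \<equiv> affine_space_U n v P"

lemma n_ge_3: "n \<ge> 3"
  using parcycle by (simp add: parcycle_def)

lemma bij_v: "bij_betw v {1..n} UNIV"
  using parcycle by (simp add: parcycle_def)

lemma w_0: "w 0 = w n"
  using n_ge_3 by (simp add: w_def)

lemma w_n: "w n = v n"
  by (simp add: w_def)

lemma inj_on_w: "inj_on w {1..n}"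
proof -
  have "inj_on w {1..n} \<longleftrightarrow> inj_on v {1..n}"
    by (intro inj_on_cong) (simp add: w_def)
  then show ?thesis using bij_v by (simp add: bij_betw_def)
qed

lemma w_eq_iff: "i \<in> {1..n} \<Longrightarrow> j \<in> {1..n} \<Longrightarrow> w i = w j \<longleftrightarrow> i = j"
  using inj_on_w by (rule inj_on_eq_iff)

lemma range_w: "w ` {1..n} = UNIV"
proof -
  have "w ` {1..n} = v ` {1..n}"
    by (intro image_cong) (auto simp: w_def)
  then show ?thesis using bij_v by (simp add: bij_betw_def)
qed

lemma vertex_cases:
  obtains i where "i \<in> {1..n}" "x = w i"
  using range_w by (metis UNIV_I imageE)

lemma finite_relevant: "finite relevant"
  by (simp add: relevant_def)

lemma relevant_subset: "relevant \<subseteq> {1..n}"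
  by (auto simp: relevant_def)

lemma edge_iff:
  "{a, b} \<in> cycle_edges n v \<longleftrightarrow> (\<exists>j\<in>{1..n}. {a, b} = {w (j - 1), w j})"
proof
  assume "{a, b} \<in> cycle_edges n v"
  then consider i where "{a, b} = {v i, v (i + 1)}" "1 \<le> i" "i \<le> n - 1" | "{a, b} = {v 1, v n}"
    by (auto simp: cycle_edges_def)
  then show "\<exists>j\<in>{1..n}. {a, b} = {w (j - 1), w j}"
  proof cases
    case 1
    then show ?thesis
      using n_ge_3 by (intro bexI[of _ "i + 1"]) (auto simp: w_def)
  next
    case 2
    then show ?thesis
      using n_ge_3 by (intro bexI[of _ 1]) (auto simp: w_def)
  qed
next
  assume "\<exists>j\<in>{1..n}. {a, b} = {w (j - 1), w j}"
  then obtain j where j: "j \<in> {1..n}" "{a, b} = {w (j - 1), w j}" by blast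
  show "{a, b} \<in> cycle_edges n v"
  proof (cases "j = 1")
    case True
    then show ?thesis
      using j by (auto simp: cycle_edges_def w_def)
  next
    case False
    then have "{a, b} = {v (j - 1), v (j - 1 + 1)}" "1 \<le> j - 1" "j - 1 \<le> n - 1"
      using j by (auto simp: w_def)
    then show ?thesis
      unfolding cycle_edges_def by blast
  qed
qed

lemma edge: "j \<in> {1..n} \<Longrightarrow> {w (j - 1), w j} \<in> cycle_edges n v"
  using edge_iff by blast

lemma relevant_edge_commute: "relevant_edge E P a b = relevant_edge E P b a"
  by (auto simp: relevant_edge_def insert_commute)

lemma relevant_edge_iff:
  "relevant_edge (cycle_edges n v) P a b \<longleftrightarrow>
     (\<exists>j\<in>relevant. a = w (j - 1) \<and> b = w j \<or> a = w j \<and> b = w (j - 1))" (is "?l \<longleftrightarrow> ?r")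
proof
  assume l: ?l
  then have "{a, b} \<in> cycle_edges n v"
    by (simp add: relevant_edge_def)
  then obtain j where j: "j \<in> {1..n}" "{a, b} = {w (j - 1), w j}"
    by (rule bexE[OF iffD1[OF edge_iff]])
  from j(2) consider "a = w (j - 1)" "b = w j" | "a = w j" "b = w (j - 1)"
    by (auto simp only: doubleton_eq_iff)
  then show ?r
  proof cases
    case 1
    then have "j \<in> relevant" using l j unfolding relevant_def by blast
    with 1 show ?thesis by blast
  next
    case 2
    then have "j \<in> relevant"
      using l j unfolding relevant_edge_commute[of _ a b] relevant_def by blast
    with 2 show ?thesis by blast
  qed
next
  assume ?r
  then obtain j where "j \<in> relevant" "a = w (j - 1) \<and> b = w j \<or> a = w j \<and> b = w (j - 1)"
    by blast
  then show ?l
    using relevant_edge_commute[of "cycle_edges n v" a b] unfolding relevant_def by blast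
qed

section \<open>Jumps as linear coordinates, and the affine space in terms of them\<close>

lemma jump_add [simp]: "jump (p + q) j = jump p j + jump q j"
  and jump_diff [simp]: "jump (p - q) j = jump p j - jump q j"
  and jump_scaleR [simp]: "jump (c *\<^sub>R p) j = c * jump p j"
  and jump_0 [simp]: "jump 0 j = 0"
  by (simp_all add: jump_def algebra_simps)

lemma total_add [simp]: "total (p + q) = total p + total q"
  and total_diff [simp]: "total (p - q) = total p - total q"
  and total_scaleR [simp]: "total (c *\<^sub>R p) = c * total p"
  and total_0 [simp]: "total 0 = 0"
  by (simp_all add: total_def sum.distrib sum_subtractf sum_distrib_left)

lemma jump_sum: "jump (\<Sum>x\<in>A. f x) j = (\<Sum>x\<in>A. jump (f x) j)"
  by (simp add: jump_def sum_subtractf)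

lemma total_sum: "total (\<Sum>x\<in>A. f x) = (\<Sum>x\<in>A. total (f x))"
  unfolding total_def by (simp add: sum.swap[of _ A])

lemma coordinate_eq: "p $ w i = p $ w n + (\<Sum>j = 1..i. jump p j)"
  by (induction i) (simp_all add: jump_def w_0)

text \<open>One full turn leads back to \<open>w n\<close>. This relation is what forces positive
  and negative jumps to occur together.\<close>

lemma sum_jump: "(\<Sum>j = 1..n. jump p j) = 0"
  using coordinate_eq[of p n] by simp

lemma eq_0_if_jumps_0:
  assumes "p $ w n = 0" "\<And>j. j \<in> {1..n} \<Longrightarrow> jump p j = 0"
  shows "p = 0"
proof -
  have "p $ x = 0" for x
  proof -
    obtain i where i: "i \<in> {1..n}" "x = w i" by (rule vertex_cases)
    then have "(\<Sum>j = 1..i. jump p j) = 0"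
      using assms(2) by (intro sum.neutral) auto
    then show ?thesis
      using coordinate_eq[of p i] assms(1) i(2) by simp
  qed
  then show ?thesis by (simp add: vec_eq_iff)
qed

text \<open>Connectedness of the parts enters here: two vertices of a part are joined by a path
  inside it, which crosses only irrelevant edges. Conversely an irrelevant edge has both ends in one
  part.\<close>

lemma constant_on_parts_iff:
  "(\<forall>V\<in>P. \<forall>u\<in>V. \<forall>u'\<in>V. p $ u = p $ u') \<longleftrightarrow> (\<forall>j\<in>{1..n} - relevant. jump p j = 0)"
proof
  assume const: "\<forall>V\<in>P. \<forall>u\<in>V. \<forall>u'\<in>V. p $ u = p $ u'"
  show "\<forall>j\<in>{1..n} - relevant. jump p j = 0"
  proof
    fix j assume "j \<in> {1..n} - relevant"
    then obtain V where "V \<in> P" "w (j - 1) \<in> V" "w j \<in> V"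
      using edge[of j] by (auto simp: relevant_def relevant_edge_def)
    then show "jump p j = 0"
      using const by (metis diff_self jump_def)
  qed
next
  assume jumps: "\<forall>j\<in>{1..n} - relevant. jump p j = 0"
  show "\<forall>V\<in>P. \<forall>u\<in>V. \<forall>u'\<in>V. p $ u = p $ u'"
  proof (intro ballI)
    fix V u u' assume V: "V \<in> P" "u \<in> V" "u' \<in> V"
    then have "(u, u') \<in> {(a, b). a \<in> V \<and> b \<in> V \<and> {a, b} \<in> cycle_edges n v}\<^sup>*"
      using parcycle by (auto simp: parcycle_def induces_connected_def)
    then show "p $ u = p $ u'"
    proof (induction rule: rtrancl_induct)
      case (step y z)
      then have yz: "y \<in> V" "z \<in> V" "{y, z} \<in> cycle_edges n v" by auto
      then obtain j where j: "j \<in> {1..n}" "{y, z} = {w (j - 1), w j}"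
        by (auto simp: edge_iff)
      then have "w (j - 1) \<in> V" "w j \<in> V"
        using yz by (auto simp: doubleton_eq_iff)
      then have "j \<notin> relevant"
        using V(1) by (auto simp: relevant_def relevant_edge_def)
      then have "jump p j = 0" using jumps j by simp
      then have "p $ y = p $ z"
        using j by (auto simp: doubleton_eq_iff jump_def)
      with step.IH show ?case by simp
    qed simp
  qed
qed

lemma U_iff:
  "p \<in> U \<longleftrightarrow> p $ w n = 0 \<and> total p = 1 \<and> (\<forall>j\<in>{1..n} - relevant. jump p j = 0)"
proof -
  have "(\<Sum>i = 1..n - 1. p $ v i) = total p"
    unfolding total_def by (intro sum.cong) (auto simp: w_def)
  then show ?thesis
    by (simp add: affine_space_U_def constant_on_parts_iff w_n)
qed

lemma U_diff: "p \<in> U \<Longrightarrow> q \<in> U \<Longrightarrow> q - p \<in> directions"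
  by (simp add: U_iff directions_def)

lemma U_add: "p \<in> U \<Longrightarrow> d \<in> directions \<Longrightarrow> p + s *\<^sub>R d \<in> U"
  by (simp add: U_iff directions_def)

text \<open>Irrelevant edges may be included because jumps across them vanish on all of
  \<open>U\<close>; traversing an edge in the other direction only negates both signs.\<close>

lemma open_cell_eq:
  assumes "p \<in> U"
  shows "open_cell n v P p = {q \<in> U. \<forall>j\<in>{1..n}. sgn (jump q j) = sgn (jump p j)}"
proof -
  have "(\<forall>a b. relevant_edge (cycle_edges n v) P a b \<longrightarrow> sgn (q $ a - q $ b) = sgn (p $ a - p $ b)) \<longleftrightarrow>
      (\<forall>j\<in>{1..n}. sgn (jump q j) = sgn (jump p j))" (is "?l \<longleftrightarrow> ?r") if "q \<in> U" for q
  proof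
    assume l: ?l
    show ?r
    proof
      fix j assume j: "j \<in> {1..n}"
      show "sgn (jump q j) = sgn (jump p j)"
      proof (cases "j \<in> relevant")
        case True
        then show ?thesis
          using l unfolding jump_def relevant_edge_iff by blast
      next
        case False
        then show ?thesis
          using assms that j by (simp add: U_iff)
      qed
    qed
  next
    assume r: ?r
    show ?l
    proof (intro allI impI)
      fix a b assume "relevant_edge (cycle_edges n v) P a b"
      then obtain j where j: "j \<in> relevant" "a = w (j - 1) \<and> b = w j \<or> a = w j \<and> b = w (j - 1)"
        unfolding relevant_edge_iff by blast
      then have "sgn (jump q j) = sgn (jump p j)" "sgn (- jump q j) = sgn (- jump p j)"
        using r relevant_subset by (auto simp: sgn_minus)
      then show "sgn (q $ a - q $ b) = sgn (p $ a - p $ b)"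
        using j by (auto simp: jump_def)
    qed
  qed
  then show ?thesis
    by (auto simp: open_cell_def)
qed

section \<open>Sign patterns and closed cells\<close>

definition ups :: "real ^ 'n \<Rightarrow> nat set" where
  "ups p = {j \<in> {1..n}. jump p j > 0}"

definition downs :: "real ^ 'n \<Rightarrow> nat set" where
  "downs p = {j \<in> {1..n}. jump p j < 0}"

definition Cell :: "nat set \<Rightarrow> nat set \<Rightarrow> (real ^ 'n) set" where
  "Cell A B = {q \<in> U. (\<forall>j\<in>A. 0 \<le> jump q j) \<and> (\<forall>j\<in>B. jump q j \<le> 0) \<and>
     (\<forall>j\<in>{1..n} - A - B. jump q j = 0)}"

lemma continuous_on_jump: "continuous_on S (\<lambda>q. jump q j)"
  unfolding jump_def by (intro continuous_intros)

lemma closed_U: "closed U"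
proof -
  have "U = {p. p $ w n = 0} \<inter> {p. total p = 1} \<inter> (\<Inter>j\<in>{1..n} - relevant. {p. jump p j = 0})"
    by (auto simp: U_iff)
  moreover have "closed \<dots>"
    unfolding total_def
    by (intro closed_Int closed_INT ballI closed_Collect_eq continuous_intros continuous_on_jump)
  ultimately show ?thesis by simp
qed

lemma closed_Cell: "closed (Cell A B)"
proof -
  have "Cell A B = U \<inter> (\<Inter>j\<in>A. {q. 0 \<le> jump q j}) \<inter> (\<Inter>j\<in>B. {q. jump q j \<le> 0}) \<inter>
      (\<Inter>j\<in>{1..n} - A - B. {q. jump q j = 0})"
    by (auto simp: Cell_def)
  moreover have "closed \<dots>"
    by (intro closed_Int closed_U closed_INT ballI closed_Collect_eq closed_Collect_le
        continuous_intros continuous_on_jump)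
  ultimately show ?thesis by simp
qed

text \<open>The segment from a point \<open>q\<close> of the closed cell to \<open>p\<close> lies in
  the open cell except possibly for \<open>q\<close>: at every edge the jump of \<open>q\<close> is
  zero or has the sign of that of \<open>p\<close>. The other inclusion is closedness of
  \<open>Cell\<close>.\<close>

lemma closure_open_cell:
  assumes "p \<in> U"
  shows "closure (open_cell n v P p) = Cell (ups p) (downs p)"
proof
  have "open_cell n v P p \<subseteq> Cell (ups p) (downs p)"
  proof
    fix q assume "q \<in> open_cell n v P p"
    then have q: "q \<in> U" "\<And>j. j \<in> {1..n} \<Longrightarrow> sgn (jump q j) = sgn (jump p j)"
      using open_cell_eq[OF assms] by auto
    show "q \<in> Cell (ups p) (downs p)"
      unfolding Cell_def
    proof (intro CollectI conjI ballI q(1))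
      fix j assume "j \<in> ups p"
      then have "sgn (jump q j) = 1" using q(2)[of j] by (simp add: ups_def)
      then show "0 \<le> jump q j" by (simp add: sgn_if split: if_splits)
    next
      fix j assume "j \<in> downs p"
      then have "sgn (jump q j) = -1" using q(2)[of j] by (simp add: downs_def)
      then show "jump q j \<le> 0" by (simp add: sgn_if split: if_splits)
    next
      fix j assume "j \<in> {1..n} - ups p - downs p"
      then have "jump p j = 0" "j \<in> {1..n}" by (auto simp: ups_def downs_def not_less order_antisym)
      then have "sgn (jump q j) = 0" using q(2)[of j] by simp
      then show "jump q j = 0" by (simp add: sgn_zero_iff)
    qed
  qed
  then show "closure (open_cell n v P p) \<subseteq> Cell (ups p) (downs p)"
    by (rule closure_minimal[OF _ closed_Cell])
next
  show "Cell (ups p) (downs p) \<subseteq> closure (open_cell n v P p)"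
  proof
    fix q assume q: "q \<in> Cell (ups p) (downs p)"
    then have qU: "q \<in> U" by (simp add: Cell_def)
    have mem: "q + t *\<^sub>R (p - q) \<in> open_cell n v P p" if t: "0 < t" "t \<le> 1" for t
      unfolding open_cell_eq[OF assms]
    proof (intro CollectI conjI ballI)
      show "q + t *\<^sub>R (p - q) \<in> U"
        by (rule U_add[OF qU U_diff[OF qU assms]])
      fix j assume j: "j \<in> {1..n}"
      have jump: "jump (q + t *\<^sub>R (p - q)) j = (1 - t) * jump q j + t * jump p j"
        by (simp add: algebra_simps)
      consider "jump p j > 0" | "jump p j < 0" | "jump p j = 0" by linarith
      then show "sgn (jump (q + t *\<^sub>R (p - q)) j) = sgn (jump p j)"
      proof cases
        case 1
        then have "0 \<le> jump q j" using q j by (simp add: Cell_def ups_def)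
        then have "0 < (1 - t) * jump q j + t * jump p j"
          using t 1 by (intro add_nonneg_pos) auto
        then show ?thesis using 1 unfolding jump by simp
      next
        case 2
        then have "jump q j \<le> 0" using q j by (simp add: Cell_def downs_def)
        then have "(1 - t) * jump q j + t * jump p j < 0"
          using t 2 by (intro add_nonpos_neg) (auto simp: mult_nonneg_nonpos mult_pos_neg)
        then show ?thesis using 2 unfolding jump by simp
      next
        case 3
        then have "jump q j = 0" using q j by (simp add: Cell_def ups_def downs_def)
        then show ?thesis using 3 unfolding jump by simp
      qed
    qed
    show "q \<in> closure (open_cell n v P p)"
      unfolding closure_approachable
    proof (intro allI impI)
      fix e :: real assume "0 < e"
      \<comment> \<open>A step short enough to stay within \<open>e\<close> of \<open>q\<close>; the
        added 1 avoids division by zero when \<open>p = q\<close>.\<close>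
      define t where "t = min 1 (e / (norm (p - q) + 1))"
      have t: "0 < t" "t \<le> 1"
        using \<open>0 < e\<close> by (auto simp: t_def add_nonneg_pos)
      have "t * norm (p - q) < t * (norm (p - q) + 1)"
        using t by simp
      also have "\<dots> \<le> e / (norm (p - q) + 1) * (norm (p - q) + 1)"
        by (intro mult_right_mono) (auto simp: t_def)
      also have "\<dots> = e"
        using norm_ge_zero[of "p - q"] by (simp add: add_nonneg_eq_0_iff)
      finally have "dist (q + t *\<^sub>R (p - q)) q < e"
        using t by (simp add: dist_norm)
      then show "\<exists>y\<in>open_cell n v P p. dist y q < e"
        using mem[OF t] by blast
    qed
  qed
qed

text \<open>Jumps of a single sign that sum to zero all vanish; then \<open>p = 0\<close>, against
  \<open>total p = 1\<close>.\<close>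

lemma ups_downs_nonempty:
  assumes "p \<in> U"
  shows "ups p \<noteq> {}" "downs p \<noteq> {}"
proof -
  have False if "(\<forall>j\<in>{1..n}. jump p j \<le> 0) \<or> (\<forall>j\<in>{1..n}. 0 \<le> jump p j)"
  proof -
    have "\<forall>j\<in>{1..n}. jump p j = 0"
    proof (cases "\<forall>j\<in>{1..n}. 0 \<le> jump p j")
      case True
      then show ?thesis using sum_nonneg_eq_0_iff[of "{1..n}" "jump p"] sum_jump[of p] by simp
    next
      case False
      then have "\<forall>j\<in>{1..n}. 0 \<le> - jump p j" using that by auto
      then show ?thesis
        using sum_nonneg_eq_0_iff[of "{1..n}" "\<lambda>j. - jump p j"] sum_jump[of p] by (simp add: sum_negf)
    qed
    then have "p = 0"
      using assms by (intro eq_0_if_jumps_0) (auto simp: U_iff)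
    then show False using assms by (simp add: U_iff)
  qed
  then show "ups p \<noteq> {}" "downs p \<noteq> {}"
    by (force simp: ups_def downs_def not_less)+
qed

lemma ups_downs_relevant:
  assumes "p \<in> U"
  shows "ups p \<subseteq> relevant" "downs p \<subseteq> relevant"
  using assms by (force simp: ups_def downs_def U_iff)+


section \<open>Barycentres of stretches\<close>

text \<open>Since edge \<open>j\<close> ends at \<open>w j\<close>, this is the arc entered through
  edge \<open>a\<close> and left through edge \<open>b\<close>. For \<open>1 \<le> a\<close> and
  \<open>b \<le> n\<close> it misses \<open>w n\<close>.\<close>

definition stretch :: "nat \<Rightarrow> nat \<Rightarrow> 'n set" where
  "stretch a b = w ` {a..<b}"

text \<open>The index 0 is allowed because edge 1 starts at \<open>w 0\<close>, which is the vertex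
  \<open>w n\<close>.\<close>

lemma w_in_stretch_iff:
  assumes "1 \<le> a" "b \<le> n" "i \<le> n"
  shows "w i \<in> stretch a b \<longleftrightarrow> a \<le> i \<and> i < b"
proof (cases "i = 0")
  case True
  have "w n \<notin> stretch a b"
  proof
    assume "w n \<in> stretch a b"
    then obtain j where "j \<in> {a..<b}" "w n = w j" by (auto simp: stretch_def)
    then show False using assms w_eq_iff[of n j] by simp
  qed
  then show ?thesis using True assms w_0 by simp
next
  case False
  then have "w i \<in> stretch a b \<longleftrightarrow> (\<exists>j\<in>{a..<b}. i = j)"
    unfolding stretch_def image_iff using assms by (intro bex_cong refl w_eq_iff) auto
  then show ?thesis by auto
qed

lemma card_stretch: "1 \<le> a \<Longrightarrow> b \<le> n \<Longrightarrow> card (stretch a b) = b - a"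
  unfolding stretch_def by (subst card_image) (auto intro: inj_on_subset[OF inj_on_w])

lemma barycentre_stretch:
  assumes "1 \<le> a" "a < b" "b \<le> n" "i \<le> n"
  shows "barycentre (stretch a b) $ w i = (if a \<le> i \<and> i < b then 1 / real (b - a) else 0)"
  using assms by (simp add: barycentre_def card_stretch w_in_stretch_iff indicator_def)

lemma jump_barycentre:
  assumes "1 \<le> a" "a < b" "b \<le> n" "j \<in> {1..n}"
  shows "jump (barycentre (stretch a b)) j = (of_bool (j = a) - of_bool (j = b)) / real (b - a)"
proof -
  have "a \<le> j - 1 \<longleftrightarrow> a < j" "j - 1 < b \<longleftrightarrow> j \<le> b" using assms by auto
  moreover have "j - 1 \<le> n" "j \<le> n" using assms by auto
  ultimately show ?thesis
    using assms(1-3) by (auto simp: jump_def barycentre_stretch)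
qed

lemma barycentre_in_U:
  assumes "a \<in> relevant" "b \<in> relevant" "a < b"
  shows "barycentre (stretch a b) \<in> U"
proof -
  have ab: "1 \<le> a" "a < b" "b \<le> n"
    using assms relevant_subset by auto
  have "total (barycentre (stretch a b)) = (\<Sum>i = 1..n - 1. if a \<le> i \<and> i < b then 1 / real (b - a) else 0)"
    unfolding total_def using ab by (intro sum.cong refl barycentre_stretch) auto
  also have "\<dots> = (\<Sum>i\<in>{a..<b}. 1 / real (b - a))"
    using ab by (intro sum.mono_neutral_cong_right) auto
  also have "\<dots> = 1" using ab by simp
  finally show ?thesis
    using ab assms by (auto simp: U_iff barycentre_stretch jump_barycentre)
qed

end


section \<open>Bounded cells\<close>

lemma sgn_add_mult_eq:
  fixes x y s :: real
  assumes "sgn y = sgn x" "0 \<le> s"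
  shows "sgn (x + s * y) = sgn x"
proof (cases x "0::real" rule: linorder_cases)
  case less
  then have "y < 0" using assms(1) by (metis sgn_less)
  then have "s * y \<le> 0" using assms(2) by (simp add: mult_nonneg_nonpos)
  then have "x + s * y < 0" using less by linarith
  then show ?thesis using less by simp
next
  case equal
  then show ?thesis using assms(1) by (simp add: sgn_zero_iff)
next
  case greater
  then have "y > 0" using assms(1) by (metis sgn_greater)
  then have "0 \<le> s * y" using assms(2) by simp
  then have "0 < x + s * y" using greater by linarith
  then show ?thesis using greater by simp
qed

context parcycle_setting
begin

definition valid :: "nat set \<Rightarrow> nat set \<Rightarrow> bool" where
  "valid A B \<longleftrightarrow> A \<noteq> {} \<and> B \<noteq> {} \<and> A \<subseteq> relevant \<and> B \<subseteq> relevant \<and> (\<forall>a\<in>A. \<forall>b\<in>B. a < b)"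

lemma validD:
  assumes "valid A B"
  shows "A \<noteq> {}" "B \<noteq> {}" "A \<subseteq> relevant" "B \<subseteq> relevant" "finite A" "finite B" "A \<inter> B = {}"
    "A \<subseteq> {1..n}" "B \<subseteq> {1..n}"
    and "a \<in> A \<Longrightarrow> b \<in> B \<Longrightarrow> a < b"
  using assms relevant_subset finite_subset[OF _ finite_relevant] by (auto simp: valid_def)

lemma valid_subset:
  "valid A B \<Longrightarrow> A' \<subseteq> A \<Longrightarrow> B' \<subseteq> B \<Longrightarrow> A' \<noteq> {} \<Longrightarrow> B' \<noteq> {} \<Longrightarrow> valid A' B'"
  unfolding valid_def by (meson subset_trans subsetD)

text \<open>Take the average of the barycentres over all pairs in \<open>A \<times> B\<close>. Each
  has a positive jump only at its \<open>a\<close> and a negative one only at its \<open>b\<close>;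
  as \<open>A\<close> and \<open>B\<close> are disjoint, nothing cancels.\<close>

lemma valid_interior_point:
  assumes "valid A B"
  obtains p where "p \<in> U" "ups p = A" "downs p = B"
proof
  note AB = validD[OF assms]
  \<comment> \<open>The number of pairs; dividing by it makes the total 1.\<close>
  define c where "c = real (card A * card B)"
  have c: "c > 0" using AB by (simp add: c_def card_gt_0_iff)
  define r where "r = (\<Sum>a\<in>A. \<Sum>b\<in>B. barycentre (stretch a b))"
  define p where "p = (1 / c) *\<^sub>R r"
  have U: "barycentre (stretch a b) \<in> U" if "a \<in> A" "b \<in> B" for a b
    using that AB by (intro barycentre_in_U) auto
  have coord: "p $ w n = 0"
    using U by (simp add: p_def r_def U_iff)
  have tot: "total p = 1"
  proof -
    have "total r = (\<Sum>a\<in>A. \<Sum>b\<in>B. 1)"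
      unfolding r_def total_sum using U by (intro sum.cong refl) (simp add: U_iff)
    then have "total r = c" by (simp add: c_def)
    then show ?thesis using c by (simp add: p_def)
  qed
  have jump_r: "jump r j = (\<Sum>a\<in>A. \<Sum>b\<in>B. (of_bool (j = a) - of_bool (j = b)) / real (b - a))"
    if "j \<in> {1..n}" for j
    unfolding r_def jump_sum
  proof (intro sum.cong refl)
    fix a b assume "a \<in> A" "b \<in> B"
    then have "1 \<le> a" "a < b" "b \<le> n" using AB(8-10) by auto
    then show "jump (barycentre (stretch a b)) j = (of_bool (j = a) - of_bool (j = b)) / real (b - a)"
      using that by (rule jump_barycentre)
  qed
  have 0: "jump p j = 0" if "j \<in> {1..n}" "j \<notin> A" "j \<notin> B" for j
  proof -
    have "jump r j = 0"
      unfolding jump_r[OF that(1)] using that by (intro sum.neutral ballI) auto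
    then show ?thesis by (simp add: p_def)
  qed
  have up: "jump p j > 0" if "j \<in> A" for j
  proof -
    have j: "j \<in> {1..n}" "j \<notin> B" using that AB by auto
    have "jump r j = (\<Sum>a\<in>A. \<Sum>b\<in>B. of_bool (j = a) / real (b - a))"
      unfolding jump_r[OF j(1)] using j by (intro sum.cong refl) auto
    moreover have "0 < (\<Sum>b\<in>B. of_bool (j = j) / real (b - j))"
      using AB(2,6) AB(10)[OF that] by (intro sum_pos) auto
    then have "0 < (\<Sum>a\<in>A. \<Sum>b\<in>B. of_bool (j = a) / real (b - a))"
      using that AB(5) by (intro sum_pos2[of A j]) (auto intro: sum_nonneg)
    ultimately show ?thesis using c by (simp add: p_def)
  qed
  have down: "jump p j < 0" if "j \<in> B" for j
  proof -
    have j: "j \<in> {1..n}" "j \<notin> A" using that AB by auto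
    have "- jump r j = (\<Sum>a\<in>A. \<Sum>b\<in>B. of_bool (j = b) / real (b - a))"
      unfolding jump_r[OF j(1)] sum_negf[symmetric] using j by (intro sum.cong refl) auto
    moreover have "0 < (\<Sum>b\<in>B. of_bool (j = b) / real (b - a))" if "a \<in> A" for a
      using \<open>j \<in> B\<close> AB(6) AB(10)[OF that] by (intro sum_pos2[of B j]) auto
    then have "0 < (\<Sum>a\<in>A. \<Sum>b\<in>B. of_bool (j = b) / real (b - a))"
      by (rule sum_pos[OF AB(5,1)])
    ultimately show ?thesis using c by (simp add: p_def divide_simps)
  qed
  show "p \<in> U"
    using coord tot 0 AB(3,4) unfolding U_iff by blast
  show "ups p = A"
  proof (intro set_eqI iffI)
    fix j assume "j \<in> ups p"
    then show "j \<in> A"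
      using 0[of j] down[of j] by (force simp: ups_def)
  next
    fix j assume "j \<in> A"
    then show "j \<in> ups p" using up AB(8) by (auto simp: ups_def)
  qed
  show "downs p = B"
  proof (intro set_eqI iffI)
    fix j assume "j \<in> downs p"
    then show "j \<in> B"
      using 0[of j] up[of j] by (force simp: downs_def)
  next
    fix j assume "j \<in> B"
    then show "j \<in> downs p" using down AB(9) by (auto simp: downs_def)
  qed
qed

lemma mem_Cell_ups_downs: "p \<in> U \<Longrightarrow> p \<in> Cell (ups p) (downs p)"
  by (auto simp: Cell_def ups_def downs_def not_less order_antisym)

text \<open>Before the first element of \<open>B\<close> the coordinate is a sum of nonnegative
  jumps starting from 0. Beyond an element of \<open>B\<close> no positive jump is left, and the
  remaining nonpositive jumps lead back to 0.\<close>

lemma Cell_nonneg: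
  assumes q: "q \<in> Cell A B" and AB: "\<And>a b. a \<in> A \<Longrightarrow> b \<in> B \<Longrightarrow> a < b" and i: "i \<in> {1..n}"
  shows "0 \<le> q $ w i"
proof -
  have q_n: "q $ w n = 0" using q by (simp add: Cell_def U_iff)
  have up: "0 \<le> jump q j" if "j \<in> {1..n}" "j \<notin> B" for j
    using q that by (cases "j \<in> A") (auto simp: Cell_def)
  have down: "jump q j \<le> 0" if "j \<in> {1..n}" "j \<notin> A" for j
    using q that by (cases "j \<in> B") (auto simp: Cell_def)
  show ?thesis
  proof (cases "\<exists>b\<in>B. b \<le> i")
    case False
    then have "0 \<le> (\<Sum>j = 1..i. jump q j)"
      using i by (intro sum_nonneg up) auto
    then show ?thesis using coordinate_eq[of q i] q_n by simp
  next
    case True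
    then have "j \<notin> A" if "i < j" for j using AB that by force
    then have "(\<Sum>j = Suc i..n. jump q j) \<le> 0"
      by (intro sum_nonpos down) auto
    moreover have "(\<Sum>j = 1..i. jump q j) + (\<Sum>j = Suc i..n. jump q j) = 0"
      using sum_jump[of q] i sum.ub_add_nat[of 1 i "jump q" "n - i"] by simp
    ultimately show ?thesis using coordinate_eq[of q i] q_n by simp
  qed
qed

text \<open>Nonnegative coordinates that sum to 1 lie between 0 and 1.\<close>

lemma bounded_Cell:
  assumes "\<And>a b. a \<in> A \<Longrightarrow> b \<in> B \<Longrightarrow> a < b"
  shows "bounded (Cell A B)"
proof (rule boundedI)
  fix q assume q: "q \<in> Cell A B"
  have "\<bar>q $ x\<bar> \<le> 1" for x
  proof -
    obtain i where i: "i \<in> {1..n}" "x = w i" by (rule vertex_cases)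
    have "q $ w i \<le> 1"
    proof (cases "i = n")
      case True
      then show ?thesis using q by (simp add: Cell_def U_iff)
    next
      case False
      have "q $ w i \<le> (\<Sum>i = 1..n - 1. q $ w i)"
      proof (rule member_le_sum)
        show "i \<in> {1..n - 1}" using i False by auto
        fix k assume "k \<in> {1..n - 1} - {i}"
        then show "0 \<le> q $ w k" by (intro Cell_nonneg[OF q assms]) auto
      qed simp
      also have "\<dots> = total q" by (simp add: total_def)
      also have "\<dots> = 1" using q by (simp add: Cell_def U_iff)
      finally show ?thesis .
    qed
    moreover have "0 \<le> q $ w i" using Cell_nonneg[OF q assms i(1)] .
    ultimately show ?thesis using i(2) by simp
  qed
  then have "(\<Sum>x\<in>UNIV. \<bar>q $ x\<bar>) \<le> (\<Sum>x\<in>(UNIV :: 'n set). 1)"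
    by (intro sum_mono)
  then show "norm q \<le> real CARD('n)"
    using norm_le_l1_cart[of q] by simp
qed

lemma unbounded_open_cell:
  assumes p: "p \<in> U" and ab: "a \<in> ups p" "b \<in> downs p" "b < a"
  shows "\<not> bounded (open_cell n v P p)"
proof
  assume "bounded (open_cell n v P p)"
  then obtain M where M: "\<And>q. q \<in> open_cell n v P p \<Longrightarrow> norm q \<le> M"
    by (auto simp: bounded_iff)
  define d where "d = p - barycentre (stretch b a)"
  have rel: "a \<in> relevant" "b \<in> relevant"
    using ups_downs_relevant[OF p] ab by auto
  have range: "1 \<le> b" "a \<le> n" using rel relevant_subset by auto
  have d: "d \<in> directions"
    unfolding d_def by (intro U_diff barycentre_in_U p rel ab(3))
  define \<delta> where "\<delta> = 1 / real (a - b)"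
  have \<delta>: "0 < \<delta>" using ab by (simp add: \<delta>_def)
  have jump_d: "jump d j = jump p j - (of_bool (j = b) - of_bool (j = a)) * \<delta>"
    if "j \<in> {1..n}" for j
    unfolding d_def \<delta>_def using jump_barycentre[OF range(1) ab(3) range(2) that] by simp
  \<comment> \<open>Subtracting the barycentre raises the positive jump at \<open>a\<close> and
    lowers the negative jump at \<open>b\<close>. Thus \<open>d\<close> has the sign pattern of
    \<open>p\<close>, and adding nonnegative multiples of it to \<open>p\<close> preserves this
    pattern.\<close>
  have sgn_d: "sgn (jump d j) = sgn (jump p j)" if "j \<in> {1..n}" for j
  proof -
    consider "j = a" | "j = b" | "j \<noteq> a" "j \<noteq> b" by blast
    then show ?thesis
    proof cases
      case 1
      then have "0 < jump p j" "0 < jump d j"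
        using ab jump_d[OF that] \<delta> by (auto simp: ups_def)
      then show ?thesis by simp
    next
      case 2
      then have "jump p j < 0" "jump d j < 0"
        using ab jump_d[OF that] \<delta> by (auto simp: downs_def)
      then show ?thesis by simp
    next
      case 3
      then show ?thesis using jump_d[OF that] by simp
    qed
  qed
  have mem: "p + s *\<^sub>R d \<in> open_cell n v P p" if "0 \<le> s" for s
    unfolding open_cell_eq[OF p]
  proof (intro CollectI conjI ballI U_add p d)
    fix j assume "j \<in> {1..n}"
    from sgn_d[OF this] show "sgn (jump (p + s *\<^sub>R d) j) = sgn (jump p j)"
      unfolding jump_add jump_scaleR using that by (rule sgn_add_mult_eq)
  qed
  have "jump d a \<noteq> 0"
    using sgn_d[of a] ab by (auto simp: ups_def)
  then have "norm d > 0" by auto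
  \<comment> \<open>Chosen so that the triangle inequality gives \<open>p + s *\<^sub>R d\<close> a
    norm above \<open>M\<close>.\<close>
  define s where "s = (\<bar>M\<bar> + norm p + 1) / norm d"
  have "s \<ge> 0" using \<open>norm d > 0\<close> by (simp add: s_def)
  have "norm (s *\<^sub>R d) = \<bar>M\<bar> + norm p + 1"
    using \<open>norm d > 0\<close> by (simp add: s_def)
  moreover have "norm (s *\<^sub>R d) \<le> norm (p + s *\<^sub>R d) + norm p"
    using norm_triangle_ineq4[of "p + s *\<^sub>R d" p] by simp
  ultimately show False
    using M[OF mem[OF \<open>s \<ge> 0\<close>]] by linarith
qed

lemma bounded_complex_eq: "bounded_complex n v P = insert {} {Cell A B | A B. valid A B}"
proof -
  have "{B \<in> arrangement_cells n v P. bounded B} = {Cell A B | A B. valid A B}"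
  proof (intro equalityI subsetI)
    fix C assume "C \<in> {B \<in> arrangement_cells n v P. bounded B}"
    then obtain p where p: "p \<in> U" "C = closure (open_cell n v P p)" "bounded C"
      by (auto simp: arrangement_cells_def)
    have "bounded (open_cell n v P p)"
      using p bounded_subset closure_subset by blast
    have "a < b" if "a \<in> ups p" "b \<in> downs p" for a b
    proof (rule ccontr)
      assume "\<not> a < b"
      moreover have "a \<noteq> b" using that by (auto simp: ups_def downs_def)
      ultimately show False
        using unbounded_open_cell[OF p(1) that] \<open>bounded (open_cell n v P p)\<close> by simp
    qed
    then have "valid (ups p) (downs p)"
      using ups_downs_nonempty[OF p(1)] ups_downs_relevant[OF p(1)] by (simp add: valid_def)
    then show "C \<in> {Cell A B | A B. valid A B}"
      using p closure_open_cell by blast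
  next
    fix C assume "C \<in> {Cell A B | A B. valid A B}"
    then obtain A B where AB: "valid A B" "C = Cell A B" by blast
    obtain p where p: "p \<in> U" "ups p = A" "downs p = B"
      using valid_interior_point[OF AB(1)] by blast
    have "C = closure (open_cell n v P p)"
      using closure_open_cell[OF p(1)] p AB by simp
    moreover have "bounded C"
      unfolding AB(2) by (rule bounded_Cell) (rule validD(10)[OF AB(1)])
    ultimately show "C \<in> {B \<in> arrangement_cells n v P. bounded B}"
      using p(1) unfolding arrangement_cells_def by blast
  qed
  then show ?thesis by (simp add: bounded_complex_def)
qed

section \<open>Inclusions and faces among the cells\<close>

lemma Cell_nonempty: "valid A B \<Longrightarrow> Cell A B \<noteq> {}"
  by (metis mem_Cell_ups_downs valid_interior_point empty_iff)

text \<open>A point of \<open>Cell A' B'\<close> with exactly these strict signs satisfies the sign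
  conditions of \<open>Cell A B\<close> only if its index sets are contained in \<open>A\<close> and
  \<open>B\<close>.\<close>

lemma Cell_subset_iff:
  assumes "valid A B" "valid A' B'"
  shows "Cell A' B' \<subseteq> Cell A B \<longleftrightarrow> A' \<subseteq> A \<and> B' \<subseteq> B"
proof
  assume sub: "Cell A' B' \<subseteq> Cell A B"
  obtain p where p: "p \<in> U" "ups p = A'" "downs p = B'"
    using valid_interior_point[OF assms(2)] by blast
  then have "p \<in> Cell A B"
    using sub mem_Cell_ups_downs by blast
  then have *: "\<And>j. j \<in> B \<Longrightarrow> jump p j \<le> 0" "\<And>j. j \<in> A \<Longrightarrow> 0 \<le> jump p j"
    "\<And>j. j \<in> {1..n} \<Longrightarrow> j \<notin> A \<Longrightarrow> j \<notin> B \<Longrightarrow> jump p j = 0"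
    by (auto simp: Cell_def)
  have "j \<in> A" if "j \<in> A'" for j
    using that *(1,3)[of j] unfolding p(2)[symmetric] ups_def by force
  moreover have "j \<in> B" if "j \<in> B'" for j
    using that *(2,3)[of j] unfolding p(3)[symmetric] downs_def by force
  ultimately show "A' \<subseteq> A \<and> B' \<subseteq> B" by blast
next
  assume sub: "A' \<subseteq> A \<and> B' \<subseteq> B"
  show "Cell A' B' \<subseteq> Cell A B"
  proof
    fix q assume q: "q \<in> Cell A' B'"
    note AB = validD[OF assms(1)]
    have zero: "jump q j = 0" if "j \<in> {1..n}" "j \<notin> A'" "j \<notin> B'" for j
      using q that unfolding Cell_def by blast
    have "0 \<le> jump q j" if "j \<in> A" for j
    proof (cases "j \<in> A'")
      case True
      then show ?thesis using q by (simp add: Cell_def)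
    next
      case False
      \<comment> \<open>Disjointness of \<open>A\<close> and \<open>B\<close> keeps \<open>j\<close>
        out of \<open>B'\<close>.\<close>
      then have "jump q j = 0" using zero that sub AB(7,8) by blast
      then show ?thesis by simp
    qed
    moreover have "jump q j \<le> 0" if "j \<in> B" for j
    proof (cases "j \<in> B'")
      case True
      then show ?thesis using q by (simp add: Cell_def)
    next
      case False
      then have "jump q j = 0" using zero that sub AB(7,9) by blast
      then show ?thesis by simp
    qed
    ultimately show "q \<in> Cell A B"
      using q sub by (auto simp: Cell_def)
  qed
qed

lemma Cell_eq_iff:
  assumes "valid A B" "valid A' B'"
  shows "Cell A' B' = Cell A B \<longleftrightarrow> A' = A \<and> B' = B"
  using Cell_subset_iff[OF assms] Cell_subset_iff[OF assms(2,1)] by blast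

lemma convex_comb_U:
  assumes "p \<in> U" "q \<in> U"
  shows "(1 - t) *\<^sub>R p + t *\<^sub>R q \<in> U"
  using U_add[OF assms(1) U_diff[OF assms], of t] by (simp add: algebra_simps)

lemma convex_Cell: "convex (Cell A B)"
  unfolding convex_alt
proof (intro ballI allI impI)
  fix x y and u :: real
  assume xy: "x \<in> Cell A B" "y \<in> Cell A B" "0 \<le> u \<and> u \<le> 1"
  then show "(1 - u) *\<^sub>R x + u *\<^sub>R y \<in> Cell A B"
    by (simp add: Cell_def convex_comb_U add_nonpos_nonpos mult_nonneg_nonpos)
qed

text \<open>At an edge outside \<open>A'\<close> and \<open>B'\<close> the jumps of the ends of a
  segment have a common weak sign. If a proper convex combination of them is zero, both are zero, so
  both ends lie in the smaller cell.\<close>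

lemma face_of_Cell_iff:
  assumes "valid A B" "valid A' B'"
  shows "Cell A' B' face_of Cell A B \<longleftrightarrow> A' \<subseteq> A \<and> B' \<subseteq> B"
proof
  assume "Cell A' B' face_of Cell A B"
  then show "A' \<subseteq> A \<and> B' \<subseteq> B"
    using Cell_subset_iff[OF assms] face_of_imp_subset by blast
next
  assume sub: "A' \<subseteq> A \<and> B' \<subseteq> B"
  show "Cell A' B' face_of Cell A B"
    unfolding face_of_def
  proof (intro conjI ballI impI convex_Cell)
    show "Cell A' B' \<subseteq> Cell A B"
      using sub Cell_subset_iff[OF assms] by blast
    fix x y z
    assume xy: "x \<in> Cell A B" "y \<in> Cell A B" and z: "z \<in> Cell A' B'" "z \<in> open_segment x y"
    then obtain u where u: "0 < u" "u < 1" "z = (1 - u) *\<^sub>R x + u *\<^sub>R y"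
      by (auto simp: in_segment)
    have zero: "jump x j = 0 \<and> jump y j = 0" if j: "j \<in> {1..n}" "j \<notin> A'" "j \<notin> B'" for j
    proof -
      have "jump z j = 0" using z j by (simp add: Cell_def)
      then have eq: "(1 - u) * jump x j + u * jump y j = 0"
        using u(3) by simp
      consider "0 \<le> jump x j" "0 \<le> jump y j" | "jump x j \<le> 0" "jump y j \<le> 0"
        using xy j by (cases "j \<in> A"; cases "j \<in> B") (auto simp: Cell_def)
      then show ?thesis
      proof cases
        case 1
        then have "(1 - u) * jump x j = 0 \<and> u * jump y j = 0"
          using eq u add_nonneg_eq_0_iff[of "(1 - u) * jump x j" "u * jump y j"] by simp
        then show ?thesis using u by simp
      next
        case 2
        then have "(1 - u) * jump x j = 0 \<and> u * jump y j = 0"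
          using eq u add_nonpos_eq_0_iff[of "(1 - u) * jump x j" "u * jump y j"]
          by (simp add: mult_nonneg_nonpos)
        then show ?thesis using u by simp
      qed
    qed
    show "x \<in> Cell A' B'" "y \<in> Cell A' B'"
      using xy zero sub by (auto simp: Cell_def)
  qed
qed


section \<open>The dimension of the cells\<close>

text \<open>The affine hull of \<open>Cell A B\<close> once \<open>S = A \<union> B\<close> for a
  valid pair. Dropping the sign conditions permits an induction over \<open>S\<close>.\<close>

definition flat :: "nat set \<Rightarrow> (real ^ 'n) set" where
  "flat S = {q \<in> U. \<forall>j\<in>{1..n} - S. jump q j = 0}"

lemma affine_flat: "affine (flat S)"
  unfolding affine_alt by (auto simp: flat_def convex_comb_U)

lemma barycentre_in_flat:
  assumes "a \<in> relevant" "b \<in> relevant" "a < b" "a \<in> S" "b \<in> S"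
  shows "barycentre (stretch a b) \<in> flat S"
proof -
  have "1 \<le> a" "b \<le> n" using assms relevant_subset by auto
  then show ?thesis
    using assms by (auto simp: flat_def barycentre_in_U jump_barycentre)
qed

lemma flat_pair:
  assumes "a \<in> relevant" "b \<in> relevant" "a < b"
  shows "flat {a, b} = {barycentre (stretch a b)}"
proof -
  have ab: "1 \<le> a" "b \<le> n" using assms relevant_subset by auto
  define p where "p = barycentre (stretch a b)"
  have p: "p \<in> flat {a, b}"
    unfolding p_def by (intro barycentre_in_flat assms) auto
  have "q = p" if q: "q \<in> flat {a, b}" for q
  proof -
    \<comment> \<open>Chosen so that \<open>r\<close> has no jump at \<open>a\<close>. Then it has
      none at \<open>b\<close> either, since all jumps sum to zero, so \<open>r = 0\<close>;
      comparing totals gives \<open>t = 1\<close>.\<close>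
    define t where "t = jump q a * real (b - a)"
    define r where "r = q - t *\<^sub>R p"
    have jump_p: "jump p a = 1 / real (b - a)"
      unfolding p_def using ab assms by (subst jump_barycentre) auto
    have off_b: "jump r j = 0" if j: "j \<in> {1..n}" "j \<noteq> b" for j
    proof (cases "j = a")
      case True
      then show ?thesis using assms(3) by (simp add: r_def jump_p t_def)
    next
      case False
      then show ?thesis using p q j by (simp add: r_def flat_def)
    qed
    have "jump r b = 0"
    proof -
      have "(\<Sum>j\<in>{1..n}. jump r j) = jump r b + (\<Sum>j\<in>{1..n} - {b}. jump r j)"
        using ab assms by (intro sum.remove) auto
      moreover have "(\<Sum>j\<in>{1..n} - {b}. jump r j) = 0"
        using off_b by (intro sum.neutral) auto
      ultimately show ?thesis using sum_jump[of r] by simp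
    qed
    then have "jump r j = 0" if "j \<in> {1..n}" for j
      using off_b that by (cases "j = b") auto
    then have "r = 0"
      using p q by (intro eq_0_if_jumps_0) (auto simp: r_def flat_def U_iff)
    then have "total q = t * total p" by (simp add: r_def)
    then have "t = 1" using p q by (simp add: flat_def U_iff)
    then show "q = p" using \<open>r = 0\<close> by (simp add: r_def)
  qed
  with p show ?thesis unfolding p_def by blast
qed

text \<open>A single point with a nonzero jump at the new edge \<open>a\<close> suffices: the right
  multiple of \<open>z - p\<close> cancels the jump of any \<open>q\<close> there, and the result is
  an affine combination of \<open>q\<close>, \<open>z\<close> and \<open>p\<close>.\<close>

lemma flat_insert:
  assumes p: "p \<in> flat (insert a S)" "jump p a \<noteq> 0" and z: "z \<in> flat S" and a: "a \<in> {1..n}" "a \<notin> S"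
  shows "flat (insert a S) = affine hull (insert p (flat S))"
proof (intro equalityI subsetI)
  fix q assume q: "q \<in> flat (insert a S)"
  define c where "c = jump q a / jump p a"
  define r where "r = z + (q - z) + c *\<^sub>R (z - p)"
  have "jump z a = 0" using z a by (simp add: flat_def)
  then have "jump r a = 0"
    using p(2) by (simp add: r_def c_def right_diff_distrib)
  then have "r \<in> flat S"
  proof -
    have "jump r j = 0" if "j \<in> {1..n} - S" for j
    proof (cases "j = a")
      case False
      then have "jump q j = 0" "jump p j = 0" "jump z j = 0"
        using q p(1) z that by (auto simp: flat_def)
      then show ?thesis by (simp add: r_def)
    qed (use \<open>jump r a = 0\<close> in simp)
    moreover have "r \<in> U"
      using q p(1) z by (auto simp: r_def flat_def U_iff algebra_simps)
    ultimately show ?thesis by (simp add: flat_def)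
  qed
  then have "r \<in> affine hull (insert p (flat S))" "z \<in> affine hull (insert p (flat S))"
    "p \<in> affine hull (insert p (flat S))"
    using z by (auto intro: hull_inc)
  moreover have "q = 1 *\<^sub>R r + (- c) *\<^sub>R z + c *\<^sub>R p"
    by (simp add: r_def algebra_simps)
  ultimately show "q \<in> affine hull (insert p (flat S))"
    using mem_affine_3[OF affine_affine_hull, of r _ z p 1 "- c" c] by simp
next
  fix q assume "q \<in> affine hull (insert p (flat S))"
  moreover have "affine hull (insert p (flat S)) \<subseteq> flat (insert a S)"
    using p(1) by (intro hull_minimal affine_flat) (auto simp: flat_def)
  ultimately show "q \<in> flat (insert a S)" by blast
qed

text \<open>The jumps on \<open>S\<close> are subject to two affine conditions, sum 0 and total 1,
  which accounts for the difference of two. The induction starts with a pair of edges, where the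
  flat is one point.\<close>

lemma aff_dim_flat:
  assumes "S \<subseteq> relevant" "card S = Suc (Suc k)"
  shows "aff_dim (flat S) = int k"
  using assms
proof (induction k arbitrary: S)
  case 0
  then obtain a b where "S = {a, b}" "a \<noteq> b"
    by (auto simp: card_Suc_eq)
  then obtain a b where S: "S = {a, b}" "a < b"
    by (metis insert_commute linorder_neqE_nat)
  then show ?case using 0 by (simp add: flat_pair)
next
  case (Suc k)
  then obtain a S' where S: "S = insert a S'" "a \<notin> S'" "card S' = Suc (Suc k)"
    by (metis card_Suc_eq)
  have rel: "a \<in> relevant" "S' \<subseteq> relevant" using S Suc.prems by auto
  have IH: "aff_dim (flat S') = int k" using Suc.IH rel(2) S(3) .
  then have "flat S' \<noteq> {}" by auto
  then obtain z where z: "z \<in> flat S'" by blast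
  have "S' \<noteq> {}" using S(3) by auto
  then obtain c where c: "c \<in> S'" by blast
  then have c_rel: "c \<in> relevant" "c \<noteq> a" using rel S by auto
  have range: "a \<in> {1..n}" "c \<in> {1..n}" using rel c_rel relevant_subset by auto
  \<comment> \<open>The barycentre of the stretch between the new edge and any old one jumps at the
    new edge.\<close>
  obtain p where p: "p \<in> flat (insert a S')" "jump p a \<noteq> 0"
  proof (cases "a < c")
    case True
    show ?thesis
      by (rule that[of "barycentre (stretch a c)"])
        (use True rel c_rel c range in \<open>auto intro!: barycentre_in_flat simp: jump_barycentre\<close>)
  next
    case False
    then have "c < a" using c_rel by simp
    show ?thesis
      by (rule that[of "barycentre (stretch c a)"])
        (use \<open>c < a\<close> rel c_rel c range in \<open>auto intro!: barycentre_in_flat simp: jump_barycentre\<close>)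
  qed
  have "p \<notin> flat S'" using p(2) range S(2) by (auto simp: flat_def)
  then have "p \<notin> affine hull (flat S')"
    using affine_flat affine_hull_eq by blast
  then show ?case
    unfolding S(1) flat_insert[OF p z range(1) S(2)]
    by (simp add: aff_dim_affine_hull aff_dim_insert IH)
qed

text \<open>From a point with strict signs a short step towards any \<open>q\<close> of the flat
  stays in the cell, and \<open>q\<close> lies on the line through the two points.\<close>

lemma affine_hull_Cell:
  assumes "valid A B"
  shows "affine hull (Cell A B) = flat (A \<union> B)"
proof (intro equalityI)
  have "Cell A B \<subseteq> flat (A \<union> B)"
    unfolding Cell_def flat_def by blast
  then show "affine hull (Cell A B) \<subseteq> flat (A \<union> B)"
    by (intro hull_minimal affine_flat)
  show "flat (A \<union> B) \<subseteq> affine hull (Cell A B)"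
  proof
    fix q assume q: "q \<in> flat (A \<union> B)"
    note AB = validD[OF assms]
    obtain p where p: "p \<in> U" "ups p = A" "downs p = B"
      using valid_interior_point[OF assms] by blast
    \<comment> \<open>\<open>m\<close> is the smallest jump of \<open>p\<close> in absolute value,
      and \<open>K\<close> bounds the jumps of \<open>q - p\<close>, with 1 added to keep it
      positive. A step of length \<open>m / K\<close> therefore reverses no sign.\<close>
    define m where "m = Min ((\<lambda>j. \<bar>jump p j\<bar>) ` (A \<union> B))"
    define K where "K = (\<Sum>j\<in>A \<union> B. \<bar>jump (q - p) j\<bar>) + 1"
    have m_le: "m \<le> \<bar>jump p j\<bar>" if "j \<in> A \<union> B" for j
      unfolding m_def using AB that by (intro Min_le) auto
    have "m \<in> (\<lambda>j. \<bar>jump p j\<bar>) ` (A \<union> B)"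
      unfolding m_def using AB by (intro Min_in) auto
    then have m: "0 < m"
      using p(2,3) by (auto simp: ups_def downs_def)
    have K: "0 < K" unfolding K_def by (simp add: add_nonneg_pos sum_nonneg)
    define e where "e = m / K"
    have e: "0 < e" using m K by (simp add: e_def)
    have small: "\<bar>e * jump (q - p) j\<bar> \<le> \<bar>jump p j\<bar>" if "j \<in> A \<union> B" for j
    proof -
      have "\<bar>jump (q - p) j\<bar> \<le> K"
        unfolding K_def using AB that
          member_le_sum[of j "A \<union> B" "\<lambda>j. \<bar>jump (q - p) j\<bar>"] by simp
      then have "e * \<bar>jump (q - p) j\<bar> \<le> e * K" using e by simp
      also have "\<dots> = m" using K by (simp add: e_def)
      finally show ?thesis using m_le[OF that] e by (simp add: abs_mult)
    qed
    define x where "x = p + e *\<^sub>R (q - p)"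
    have qU: "q \<in> U" using q by (simp add: flat_def)
    have "x \<in> U"
      unfolding x_def by (rule U_add[OF p(1) U_diff[OF p(1) qU]])
    have jump_x: "jump x j = jump p j + e * jump (q - p) j" for j
      unfolding x_def by simp
    have "x \<in> Cell A B"
      unfolding Cell_def
    proof (intro CollectI conjI ballI \<open>x \<in> U\<close>)
      fix j assume j: "j \<in> A"
      then have "jump p j > 0" using p(2) by (auto simp: ups_def)
      then show "0 \<le> jump x j" using small[of j] j jump_x[of j] by simp
    next
      fix j assume j: "j \<in> B"
      then have "jump p j < 0" using p(3) by (auto simp: downs_def)
      then show "jump x j \<le> 0" using small[of j] j jump_x[of j] by simp
    next
      fix j assume j: "j \<in> {1..n} - A - B"
      then have "jump p j = 0" "jump q j = 0"
        using p(2,3) q by (auto simp: ups_def downs_def flat_def)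
      then show "jump x j = 0" by (simp add: jump_x)
    qed
    then have "x \<in> affine hull (Cell A B)" "p \<in> affine hull (Cell A B)"
      using mem_Cell_ups_downs[OF p(1)] p by (auto intro: hull_inc)
    moreover have "q = (1 - 1 / e) *\<^sub>R p + (1 / e) *\<^sub>R x"
      using e by (simp add: x_def algebra_simps)
    ultimately show "q \<in> affine hull (Cell A B)"
      using mem_affine[OF affine_affine_hull, of p _ x "1 - 1 / e" "1 / e"] by simp
  qed
qed

lemma aff_dim_Cell:
  assumes "valid A B"
  shows "aff_dim (Cell A B) = int (card A) + int (card B) - 2"
proof -
  note AB = validD[OF assms]
  have card: "card (A \<union> B) = card A + card B" "0 < card A" "0 < card B"
    using AB by (simp_all add: card_Un_disjoint card_gt_0_iff)
  then have "card (A \<union> B) = Suc (Suc (card A + card B - 2))" by simp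
  then have "aff_dim (flat (A \<union> B)) = int (card A + card B - 2)"
    using AB by (intro aff_dim_flat) auto
  then show ?thesis
    using card by (simp add: of_nat_diff flip: affine_hull_Cell[OF assms])
qed

lemma Cell_singleton:
  assumes "a \<in> relevant" "b \<in> relevant" "a < b"
  shows "valid {a} {b}" "Cell {a} {b} = {barycentre (stretch a b)}"
proof -
  show ab: "valid {a} {b}"
    using assms by (simp add: valid_def)
  have "Cell {a} {b} \<subseteq> flat {a, b}"
    by (auto simp: Cell_def flat_def)
  then show "Cell {a} {b} = {barycentre (stretch a b)}"
    using Cell_nonempty[OF ab] unfolding flat_pair[OF assms] by blast
qed

end


section \<open>Connected parsets and labels\<close>

lemma card_optional_pair:
  "x \<noteq> y \<Longrightarrow> card ((if p then {x} else {}) \<union> (if q then {y} else {})) = of_bool p + of_bool q"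
  by (cases p; cases q) auto

context parcycle_setting
begin

lemma part_absorbs:
  assumes "A \<subseteq> P" "V \<in> P" "x \<in> V" "x \<in> \<Union>A"
  shows "V \<subseteq> \<Union>A"
proof -
  obtain V' where V': "V' \<in> A" "x \<in> V'" using assms(4) by blast
  have "disjoint P" using parcycle by (simp add: parcycle_def partition_on_def)
  then have "V = V'"
    using V' assms by (meson disjnt_iff disjointD pairwiseD disjoint_iff subsetD)
  then show ?thesis using V' by blast
qed

lemma relevantD: "j \<in> relevant \<Longrightarrow> V \<in> P \<Longrightarrow> w (j - 1) \<in> V \<Longrightarrow> w j \<notin> V"
  by (auto simp: relevant_def relevant_edge_def)

lemma relevant_if_separated:
  assumes "A \<subseteq> P" "j \<in> {1..n}" "(w (j - 1) \<in> \<Union>A) \<noteq> (w j \<in> \<Union>A)"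
  shows "j \<in> relevant"
proof -
  have "\<not> (\<exists>V\<in>P. w (j - 1) \<in> V \<and> w j \<in> V)"
    using part_absorbs[OF assms(1)] assms(3) by blast
  then show ?thesis
    using assms(2) edge[OF assms(2)] by (simp add: relevant_def relevant_edge_def)
qed

text \<open>The least and greatest indices in \<open>S\<close> give the two ends; the edges just
  outside separate \<open>S\<close> from its complement and are therefore relevant. There is no gap,
  since a path in \<open>S\<close> could neither cross it nor go around through
  \<open>w n\<close>.\<close>

lemma stretch_if_connected_parset:
  assumes S: "connected_parset (cycle_edges n v) P S" and n: "w n \<notin> S"
  obtains a b where "a \<in> relevant" "b \<in> relevant" "a < b" "S = stretch a b"
proof -
  let ?R = "{(u, w). u \<in> S \<and> w \<in> S \<and> {u, w} \<in> cycle_edges n v}"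
  obtain A where A: "A \<subseteq> P" "S = \<Union>A"
    using S by (auto simp: connected_parset_def)
  define I where "I = {i \<in> {1..n}. w i \<in> S}"
  have "finite I" by (simp add: I_def)
  have "I \<noteq> {}"
  proof -
    obtain x where "x \<in> S" using S by (auto simp: connected_parset_def)
    moreover obtain i where "i \<in> {1..n}" "x = w i" by (rule vertex_cases)
    ultimately show ?thesis by (auto simp: I_def)
  qed
  define a where "a = Min I"
  define m where "m = Max I"
  have a: "a \<in> I" "\<And>i. i \<in> I \<Longrightarrow> a \<le> i" and m: "m \<in> I" "\<And>i. i \<in> I \<Longrightarrow> i \<le> m"
    using \<open>finite I\<close> \<open>I \<noteq> {}\<close> by (simp_all add: a_def m_def)
  have range: "1 \<le> a" "a \<le> m" "m < n"
    using a m n by (auto simp: I_def order_le_less)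
  have "w (a - 1) \<notin> S"
  proof (cases "a = 1")
    case True
    then show ?thesis using n w_0 by simp
  next
    case False
    then have "a - 1 \<notin> I" using a(2)[of "a - 1"] range by auto
    then show ?thesis using False range by (auto simp: I_def)
  qed
  then have a_rel: "a \<in> relevant"
    using relevant_if_separated[OF A(1), of a] a(1) A(2) by (auto simp: I_def)
  have "w (m + 1) \<notin> S"
  proof -
    have "m + 1 \<notin> I" using m(2)[of "m + 1"] by auto
    then show ?thesis using range by (auto simp: I_def)
  qed
  then have b_rel: "m + 1 \<in> relevant"
    using relevant_if_separated[OF A(1), of "m + 1"] m(1) A(2) range by (auto simp: I_def)
  have inside: "w c \<in> S" if c: "a \<le> c" "c \<le> m" for c
  proof (rule ccontr)
    assume "w c \<notin> S"
    then have "c \<noteq> a" using a(1) by (auto simp: I_def)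
    \<comment> \<open>Invariant of a path in \<open>S\<close> starting at \<open>w a\<close>: it
      stays below the missing index \<open>c\<close>.\<close>
    have "\<exists>i\<in>{1..<c}. y = w i" if "(w a, y) \<in> ?R\<^sup>*" for y
      using that
    proof (induction rule: rtrancl_induct)
      case base
      then show ?case using range c \<open>c \<noteq> a\<close> by (intro bexI[of _ a]) auto
    next
      case (step y z)
      then obtain i where i: "1 \<le> i" "i < c" "y = w i" by auto
      obtain j where j: "j \<in> {1..n}" "{y, z} = {w (j - 1), w j}"
        using step.hyps(2) by (auto simp: edge_iff)
      have S: "y \<in> S" "z \<in> S" using step.hyps(2) by auto
      \<comment> \<open>Edge 1 ends at \<open>w 0 = w n\<close>, which is outside \<open>S\<close>;
        this blocks the way around the cycle.\<close>
      have "j \<noteq> 1"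
        using S j n w_0 by (auto simp: doubleton_eq_iff)
      then have j1: "j - 1 \<in> {1..n}" using j(1) by auto
      have in_range: "i \<in> {1..n}" using i c range by auto
      consider "y = w (j - 1)" "z = w j" | "y = w j" "z = w (j - 1)"
        using j(2) by (auto simp: doubleton_eq_iff)
      then show ?case
      proof cases
        case 1
        then have "i = j - 1" using w_eq_iff[OF in_range j1] i by simp
        moreover have "j \<noteq> c" using 1 S \<open>w c \<notin> S\<close> by auto
        ultimately show ?thesis using 1 i j(1) by (intro bexI[of _ j]) auto
      next
        case 2
        then have "i = j" using w_eq_iff[OF in_range j(1)] i by simp
        then show ?thesis using 2 i j1 by (intro bexI[of _ "j - 1"]) auto
      qed
    qed
    moreover have "(w a, w m) \<in> ?R\<^sup>*"
      using S a(1) m(1) by (auto simp: connected_parset_def induces_connected_def I_def)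
    ultimately obtain i where "i \<in> {1..<c}" "w m = w i" by blast
    then show False
      using w_eq_iff[of m i] range c by auto
  qed
  have "S = stretch a (m + 1)"
  proof (intro equalityI subsetI)
    fix x assume x: "x \<in> S"
    obtain i where i: "i \<in> {1..n}" "x = w i" by (rule vertex_cases)
    then have "i \<in> I" using x by (simp add: I_def)
    then show "x \<in> stretch a (m + 1)"
      using a(2)[of i] m(2)[of i] i by (auto simp: stretch_def)
  next
    fix x assume "x \<in> stretch a (m + 1)"
    then show "x \<in> S" using inside by (auto simp: stretch_def)
  qed
  with a_rel b_rel range show thesis by (intro that[of a "m + 1"]) auto
qed

text \<open>Only the edges \<open>a\<close> and \<open>b\<close> leave the stretch. Both are
  relevant, so no part, being connected, can straddle its border.\<close>

lemma connected_parset_stretch: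
  assumes ab: "a \<in> relevant" "b \<in> relevant" "a < b"
  shows "connected_parset (cycle_edges n v) P (stretch a b)" "w n \<notin> stretch a b"
proof -
  let ?S = "stretch a b"
  let ?R = "{(u, w). u \<in> ?S \<and> w \<in> ?S \<and> {u, w} \<in> cycle_edges n v}"
  have range: "1 \<le> a" "b \<le> n" using ab relevant_subset by auto
  note mem = w_in_stretch_iff[OF range]
  show "w n \<notin> ?S" using mem[of n] range by simp
  have union: "V \<subseteq> ?S" if V: "V \<in> P" "x \<in> V" "x \<in> ?S" for V x
  proof
    fix y assume "y \<in> V"
    then have "(x, y) \<in> {(a, b). a \<in> V \<and> b \<in> V \<and> {a, b} \<in> cycle_edges n v}\<^sup>*"
      using parcycle V by (auto simp: parcycle_def induces_connected_def)
    then show "y \<in> ?S"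
    proof (induction rule: rtrancl_induct)
      case (step y z)
      obtain j where j: "j \<in> {1..n}" "{y, z} = {w (j - 1), w j}"
        using step.hyps(2) by (auto simp: edge_iff)
      have "w (j - 1) \<in> V" "w j \<in> V"
        using step.hyps(2) j(2) by (auto simp: doubleton_eq_iff)
      then have "j \<notin> relevant" using relevantD V(1) by blast
      then have "j \<noteq> a" "j \<noteq> b" using ab by auto
      have "j - 1 \<le> n" "j \<le> n" "a \<le> j - 1 \<longleftrightarrow> a < j" "j - 1 < b \<longleftrightarrow> j \<le> b"
        using j(1) range by auto
      then have "w (j - 1) \<in> ?S \<longleftrightarrow> w j \<in> ?S"
        using mem[of j] mem[of "j - 1"] \<open>j \<noteq> a\<close> \<open>j \<noteq> b\<close> by auto
      then show ?case using step.IH j(2) by (auto simp: doubleton_eq_iff)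
    qed (rule V(3))
  qed
  have "?S = \<Union>{V \<in> P. V \<subseteq> ?S}"
  proof (intro equalityI subsetI)
    fix x assume x: "x \<in> ?S"
    have "\<Union>P = UNIV"
      using parcycle by (simp add: parcycle_def partition_on_def)
    then have "x \<in> \<Union>P" by simp
    then obtain V where "V \<in> P" "x \<in> V" by (rule UnionE)
    then show "x \<in> \<Union>{V \<in> P. V \<subseteq> ?S}" using union x by blast
  qed auto
  then have parset: "\<exists>A\<subseteq>P. ?S = \<Union>A" by (intro exI[of _ "{V \<in> P. V \<subseteq> ?S}"]) auto
  have adjacent: "(w i, w (Suc i)) \<in> ?R" "(w (Suc i), w i) \<in> ?R" if "a \<le> i" "Suc i < b" for i
    using that edge[of "Suc i"] range mem[of i] mem[of "Suc i"] by (auto simp: insert_commute)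
  have reach: "(w a, w i) \<in> ?R\<^sup>* \<and> (w i, w a) \<in> ?R\<^sup>*" if "a \<le> i" "i < b" for i
    using that
  proof (induction i rule: dec_induct)
    case (step i)
    then show ?case
      using adjacent[of i]
      by (meson Suc_lessD converse_rtrancl_into_rtrancl rtrancl.rtrancl_into_rtrancl)
  qed simp
  have "induces_connected (cycle_edges n v) ?S"
    unfolding induces_connected_def
  proof (intro ballI)
    fix x y assume "x \<in> ?S" "y \<in> ?S"
    then obtain i k where "x = w i" "y = w k" "a \<le> i" "i < b" "a \<le> k" "k < b"
      by (auto simp: stretch_def)
    then show "(x, y) \<in> ?R\<^sup>*"
      using reach[of i] reach[of k] by (auto intro: rtrancl_trans)
  qed
  moreover have "w a \<in> ?S" using ab(3) by (auto simp: stretch_def)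
  ultimately show "connected_parset (cycle_edges n v) P ?S"
    using parset unfolding connected_parset_def by blast
qed

section \<open>Out-degrees of stretches and the labels of cells\<close>

lemma neighbour_iff:
  assumes "1 \<le> i" "i < n"
  shows "{w i, x} \<in> cycle_edges n v \<longleftrightarrow> x = w (i - 1) \<or> x = w (i + 1)"
proof
  assume "{w i, x} \<in> cycle_edges n v"
  then obtain j where j: "j \<in> {1..n}" "{w i, x} = {w (j - 1), w j}"
    by (rule bexE[OF iffD1[OF edge_iff]])
  from j(2) consider "w i = w (j - 1)" "x = w j" | "w i = w j" "x = w (j - 1)"
    by (auto simp only: doubleton_eq_iff)
  then show "x = w (i - 1) \<or> x = w (i + 1)"
  proof cases
    case 1
    have "j \<noteq> 1"
      using 1 assms w_0 w_eq_iff[of i n] by auto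
    then have "i \<in> {1..n}" "j - 1 \<in> {1..n}" using j(1) assms by auto
    then have "i = j - 1" using 1(1) w_eq_iff by blast
    then show ?thesis using 1 assms by simp
  next
    case 2
    then have "i = j" using j(1) assms w_eq_iff[of i j] by auto
    then show ?thesis using 2 by simp
  qed
next
  assume "x = w (i - 1) \<or> x = w (i + 1)"
  then show "{w i, x} \<in> cycle_edges n v"
    using edge[of i] edge[of "i + 1"] assms by (auto simp: insert_commute)
qed

lemma out_degree_stretch:
  assumes ab: "a \<in> relevant" "b \<in> relevant" "a < b" and i: "i \<in> {1..n}"
  shows "out_degree (cycle_edges n v) (stretch a b) (w i) = of_bool (i = a) + of_bool (i + 1 = b)"
proof -
  have range: "1 \<le> a" "b \<le> n" using ab relevant_subset by auto
  note mem = w_in_stretch_iff[OF range]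
  show ?thesis
  proof (cases "w i \<in> stretch a b")
    case True
    then have ai: "a \<le> i" "i < b" using mem[of i] i by auto
    have 1: "1 \<le> i" "i < n" using ai range by auto
    have "w (i - 1) \<notin> stretch a b \<longleftrightarrow> i = a" "w (i + 1) \<notin> stretch a b \<longleftrightarrow> i + 1 = b"
      using mem[of "i - 1"] mem[of "i + 1"] ai 1 by auto
    then have nbrs: "{j. j \<notin> stretch a b \<and> {w i, j} \<in> cycle_edges n v} =
        (if i = a then {w (i - 1)} else {}) \<union> (if i + 1 = b then {w (i + 1)} else {})"
      unfolding neighbour_iff[OF 1] by auto
    \<comment> \<open>The two neighbours are distinct because \<open>n \<ge> 3\<close>; for
      \<open>i = 1\<close> they are \<open>w n\<close> and \<open>w 2\<close>.\<close>
    have "w (i - 1) \<noteq> w (i + 1)"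
    proof (cases "i = 1")
      case True
      then show ?thesis using n_ge_3 w_0 w_eq_iff[of n 2] by (simp add: numeral_2_eq_2)
    next
      case False
      then have "i - 1 \<in> {1..n}" "i + 1 \<in> {1..n}" using 1 by auto
      then show ?thesis using w_eq_iff[of "i - 1" "i + 1"] by simp
    qed
    then have "card ((if i = a then {w (i - 1)} else {}) \<union> (if i + 1 = b then {w (i + 1)} else {})) =
        of_bool (i = a) + of_bool (i + 1 = b)"
      by (rule card_optional_pair)
    then show ?thesis
      using True by (simp only: out_degree_def if_True nbrs)
  next
    case False
    then have "i \<noteq> a" "i + 1 \<noteq> b" using mem[of i] i ab(3) by auto
    then show ?thesis using False by (simp add: out_degree_def)
  qed
qed

text \<open>The 0-cells of \<open>Cell A B\<close> are the \<open>Cell {a} {b}\<close> with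
  \<open>(a, b)\<close> in the full product \<open>A \<times> B\<close>. Hence \<open>a = i\<close>
  and \<open>b = i + 1\<close> can be realised at the same 0-cell whenever each is available, and
  the maximum of the sum is the sum of the maxima.\<close>

lemma cell_label_Cell:
  assumes valid: "valid A B" and i: "i \<in> {1..n}"
  shows "cell_label n v P (Cell A B) (w i) = of_bool (i \<in> A) + of_bool (i + 1 \<in> B)"
proof -
  note AB = validD[OF valid]
  have set_eq: "{out_degree (cycle_edges n v) J (w i) | J.
        connected_parset (cycle_edges n v) P J \<and> v n \<notin> J \<and>
        {barycentre J} \<in> bounded_complex n v P \<and> {barycentre J} face_of Cell A B} =
      (\<lambda>(a, b). of_bool (i = a) + of_bool (i + 1 = b)) ` (A \<times> B)" (is "?L = ?R")
  proof (intro equalityI subsetI)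
    fix d assume "d \<in> ?L"
    then obtain J where J: "d = out_degree (cycle_edges n v) J (w i)"
        "connected_parset (cycle_edges n v) P J" "w n \<notin> J" "{barycentre J} face_of Cell A B"
      unfolding w_n by blast
    obtain a b where ab: "a \<in> relevant" "b \<in> relevant" "a < b" "J = stretch a b"
      using stretch_if_connected_parset[OF J(2,3)] by blast
    have "Cell {a} {b} face_of Cell A B"
      using J(4) Cell_singleton(2)[OF ab(1-3)] ab(4) by simp
    then have "a \<in> A" "b \<in> B"
      using face_of_Cell_iff[OF valid Cell_singleton(1)[OF ab(1-3)]] by auto
    then show "d \<in> ?R"
      unfolding J(1) ab(4) out_degree_stretch[OF ab(1-3) i]
      by (intro image_eqI[of _ _ "(a, b)"]) auto
  next
    fix d assume "d \<in> ?R"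
    then obtain a b where d: "d = of_bool (i = a) + of_bool (i + 1 = b)" and "a \<in> A" "b \<in> B"
      by auto
    then have ab: "a \<in> relevant" "b \<in> relevant" "a < b" using AB by auto
    have "Cell {a} {b} face_of Cell A B"
      using face_of_Cell_iff[OF valid Cell_singleton(1)[OF ab]] \<open>a \<in> A\<close> \<open>b \<in> B\<close> by auto
    moreover have "Cell {a} {b} \<in> bounded_complex n v P"
      unfolding bounded_complex_eq using Cell_singleton(1)[OF ab] by blast
    ultimately show "d \<in> ?L"
      using connected_parset_stretch[OF ab] out_degree_stretch[OF ab i] d
      unfolding Cell_singleton(2)[OF ab] w_n by force
  qed
  obtain a0 b0 where "a0 \<in> A" "b0 \<in> B" using AB(1,2) by blast
  define a where "a = (if i \<in> A then i else a0)"
  define b where "b = (if i + 1 \<in> B then i + 1 else b0)"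
  have "a \<in> A" "b \<in> B" "i \<in> A \<longleftrightarrow> i = a" "i + 1 \<in> B \<longleftrightarrow> i + 1 = b"
    using \<open>a0 \<in> A\<close> \<open>b0 \<in> B\<close> unfolding a_def b_def by (simp_all split: if_split) blast+
  then have attained: "of_bool (i \<in> A) + of_bool (i + 1 \<in> B) \<in>
      (\<lambda>(a, b). of_bool (i = a) + of_bool (i + 1 = b) :: nat) ` (A \<times> B)"
    by (intro image_eqI[of _ _ "(a, b)"]) simp_all
  have bound: "of_bool (i = a) + of_bool (i + 1 = b) \<le> (of_bool (i \<in> A) + of_bool (i + 1 \<in> B) :: nat)"
    if "a \<in> A" "b \<in> B" for a b
    using that by (intro add_mono) auto
  show ?thesis
    unfolding cell_label_def set_eq
  proof (rule Max_eqI)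
    fix y :: nat assume "y \<in> insert 0 ((\<lambda>(a, b). of_bool (i = a) + of_bool (i + 1 = b)) ` (A \<times> B))"
    then show "y \<le> of_bool (i \<in> A) + of_bool (i + 1 \<in> B)"
    proof
      assume "y \<in> (\<lambda>(a, b). of_bool (i = a) + of_bool (i + 1 = b)) ` (A \<times> B)"
      then obtain a b where "y = of_bool (i = a) + of_bool (i + 1 = b)" "a \<in> A" "b \<in> B"
        by auto
      then show ?thesis using bound by simp
    qed simp
  next
    show "of_bool (i \<in> A) + of_bool (i + 1 \<in> B) \<in>
        insert 0 ((\<lambda>(a, b). of_bool (i = a) + of_bool (i + 1 = b) :: nat) ` (A \<times> B))"
      using attained by (rule insertI2)
  qed (use AB(5,6) in simp)
qed

lemma cell_label_empty: "cell_label n v P {} = (\<lambda>i. 0)"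
proof
  fix i
  have "\<not> {x} face_of {}" for x :: "real ^ 'n"
    using face_of_imp_subset by blast
  then show "cell_label n v P {} i = 0"
    by (simp add: cell_label_def)
qed

lemma cell_label_Cell_le_iff:
  assumes "valid A B"
  shows "cell_label n v P (Cell A B) \<le> u \<longleftrightarrow>
    (\<forall>i\<in>{1..n}. of_bool (i \<in> A) + of_bool (i + 1 \<in> B) \<le> u (w i))"
proof -
  have "cell_label n v P (Cell A B) \<le> u \<longleftrightarrow>
      (\<forall>i\<in>{1..n}. cell_label n v P (Cell A B) (w i) \<le> u (w i))"
    unfolding le_fun_def by (metis vertex_cases)
  then show ?thesis by (simp add: cell_label_Cell[OF assms])
qed

lemma cell_label_singleton:
  assumes "a \<in> relevant" "b \<in> relevant" "a < b"
  shows "cell_label n v P (Cell {a} {b}) = out_degree (cycle_edges n v) (stretch a b)"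
proof
  fix x
  obtain i where "i \<in> {1..n}" "x = w i" by (rule vertex_cases)
  then show "cell_label n v P (Cell {a} {b}) x = out_degree (cycle_edges n v) (stretch a b) x"
    using cell_label_Cell[OF Cell_singleton(1)[OF assms]] out_degree_stretch[OF assms] by simp
qed

end


section \<open>The labelled complex of bounded cells\<close>

context parcycle_setting
begin

definition cell_rank :: "(real ^ 'n) set \<Rightarrow> nat" where
  "cell_rank B = nat (aff_dim B + 1)"

lemma bounded_complex_cases:
  assumes "C \<in> bounded_complex n v P"
  obtains "C = {}" | A B where "C = Cell A B" "valid A B"
  using assms unfolding bounded_complex_eq by blast

lemma Cell_in_bounded_complex: "valid A B \<Longrightarrow> Cell A B \<in> bounded_complex n v P"
  unfolding bounded_complex_eq by blast

lemma card_valid_pos: "valid A B \<Longrightarrow> 0 < card A \<and> 0 < card B"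
  using validD(1,2,5,6) by (simp add: card_gt_0_iff)

lemma cell_rank_Cell:
  assumes "valid A B"
  shows "cell_rank (Cell A B) = card A + card B - 1"
  using card_valid_pos[OF assms] by (simp add: cell_rank_def aff_dim_Cell[OF assms])

lemma cell_rank_eq_iff: "cell_rank B = i \<longleftrightarrow> aff_dim B = int i - 1"
  using aff_dim_geq[of B] by (auto simp: cell_rank_def)

lemma finite_bounded_complex: "finite (bounded_complex n v P)"
proof -
  have "{Cell A B | A B. valid A B} \<subseteq> (\<lambda>(A, B). Cell A B) ` (Pow relevant \<times> Pow relevant)"
    unfolding valid_def by auto
  then have "finite {Cell A B | A B. valid A B}"
    by (rule finite_subset) (simp add: finite_relevant)
  then show ?thesis
    unfolding bounded_complex_eq by simp
qed

lemma cell_facet_Cell_iff: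
  assumes "valid A B" "valid A' B'"
  shows "cell_facet (Cell A' B') (Cell A B) \<longleftrightarrow>
    A' \<subseteq> A \<and> B' \<subseteq> B \<and> card A + card B = Suc (card A' + card B')"
  unfolding cell_facet_def face_of_Cell_iff[OF assms] aff_dim_Cell[OF assms(1)] aff_dim_Cell[OF assms(2)]
  by auto

lemma cell_facet_empty_iff:
  assumes "valid A B"
  shows "cell_facet {} (Cell A B) \<longleftrightarrow> card A = 1 \<and> card B = 1"
  using card_valid_pos[OF assms] by (auto simp: cell_facet_def aff_dim_Cell[OF assms])

lemma not_cell_facet_of_empty: "\<not> cell_facet (C :: (real ^ 'n) set) {}"
  using face_of_imp_subset[of C "{}"] by (auto simp: cell_facet_def)

lemma cell_facet_rank:
  assumes "cell_facet B' B"
  shows "cell_rank B = Suc (cell_rank B')"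
  using assms aff_dim_geq[of B'] by (simp add: cell_facet_def cell_rank_def)

text \<open>Losing \<open>a\<close> from \<open>A\<close> lowers the exponent at \<open>w a\<close>;
  losing \<open>b\<close> from \<open>B\<close> lowers it at \<open>w (b - 1)\<close>. The index
  \<open>b - 1\<close> is at least 1 because some element of \<open>A\<close> lies below
  \<open>b\<close>.\<close>

lemma cell_label_less:
  assumes "C \<in> bounded_complex n v P" "C' \<in> bounded_complex n v P" "cell_facet C' C"
  shows "cell_label n v P C' < cell_label n v P C"
  using assms(1)
proof (cases rule: bounded_complex_cases)
  case 1
  then show ?thesis using assms(3) not_cell_facet_of_empty by blast
next
  case (2 A B)
  note AB = validD[OF 2(2)]
  have strict: "cell_label n v P C' < cell_label n v P C"
    if "\<And>i. i \<in> {1..n} \<Longrightarrow> cell_label n v P C' (w i) \<le> cell_label n v P C (w i)"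
      and "i \<in> {1..n}" "cell_label n v P C' (w i) < cell_label n v P C (w i)" for i
    unfolding less_le_not_le le_fun_def using that by (metis vertex_cases not_le)
  show ?thesis
    using assms(2)
  proof (cases rule: bounded_complex_cases)
    case 1
    obtain a where a: "a \<in> A" using AB(1) by blast
    then have "a \<in> {1..n}" using AB(8) by blast
    then show ?thesis
      using a by (intro strict[of a]) (simp_all add: 1 2 cell_label_empty cell_label_Cell)
  next
    case (2 A' B')
    note C' = this
    have sub: "A' \<subseteq> A" "B' \<subseteq> B" "card A + card B = Suc (card A' + card B')"
      using assms(3) cell_facet_Cell_iff[OF \<open>valid A B\<close> C'(2)] \<open>C = Cell A B\<close> C'(1) by auto
    have mono: "of_bool (i \<in> A') + of_bool (j \<in> B') \<le> (of_bool (i \<in> A) + of_bool (j \<in> B) :: nat)" for i j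
      using sub by (intro add_mono) auto
    have "\<exists>i\<in>{1..n}. of_bool (i \<in> A') + of_bool (i + 1 \<in> B') < (of_bool (i \<in> A) + of_bool (i + 1 \<in> B) :: nat)"
    proof (cases "A' = A")
      case False
      then obtain a where a: "a \<in> A" "a \<notin> A'" using sub by blast
      then have "of_bool (a \<in> A') + of_bool (a + 1 \<in> B') < (of_bool (a \<in> A) + of_bool (a + 1 \<in> B) :: nat)"
        using sub(2) by auto
      then show ?thesis using a AB(8) by blast
    next
      case True
      then have "B' \<noteq> B" using sub(3) by auto
      then obtain b where b: "b \<in> B" "b \<notin> B'" using sub by blast
      obtain a where "a \<in> A" using AB(1) by blast
      then have "1 \<le> a" "a < b" "b \<le> n" using b AB(8,9,10) by auto
      then have b1: "b - 1 \<in> {1..n}" "b - 1 + 1 = b" by auto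
      then have "of_bool (b - 1 \<in> A') + of_bool (b - 1 + 1 \<in> B') < (of_bool (b - 1 \<in> A) + of_bool (b - 1 + 1 \<in> B) :: nat)"
        using b True by simp
      then show ?thesis using b1(1) by blast
    qed
    then obtain i where i: "i \<in> {1..n}"
      "of_bool (i \<in> A') + of_bool (i + 1 \<in> B') < (of_bool (i \<in> A) + of_bool (i + 1 \<in> B) :: nat)" by blast
    show ?thesis
    proof (rule strict[OF _ i(1)])
      fix k assume "k \<in> {1..n}"
      then show "cell_label n v P C' (w k) \<le> cell_label n v P C (w k)"
        unfolding C'(1) \<open>C = Cell A B\<close> by (simp only: cell_label_Cell C'(2) \<open>valid A B\<close> mono)
    next
      show "cell_label n v P C' (w i) < cell_label n v P C (w i)"
        unfolding C'(1) \<open>C = Cell A B\<close> using i by (simp only: cell_label_Cell C'(2) \<open>valid A B\<close>)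
    qed
  qed
qed

lemma labelled_complex:
  assumes "incidence_function (bounded_complex n v P) \<epsilon>"
  shows "labelled_complex (bounded_complex n v P) cell_rank \<epsilon> {} cell_facet (cell_label n v P)"
proof -
  let ?X = "bounded_complex n v P"
  have incidence: "\<epsilon> B B' \<in> {0, 1, -1}" and facet: "\<epsilon> B B' \<noteq> 0 \<longleftrightarrow> cell_facet B' B"
    if "B \<in> ?X" "B' \<in> ?X" for B B'
    using assms that by (auto simp only: incidence_function_def)
  have bottom: "\<epsilon> B {} = 1" if "B \<in> ?X" "aff_dim B = 0" for B
    using assms that by (simp add: incidence_function_def)
  have sum: "(\<Sum>B'\<in>?X. \<epsilon> B B' * \<epsilon> B' B'') = 0" if "B \<in> ?X" "B'' \<in> ?X" for B B''
  proof -
    have "(\<Sum>B'\<in>?X. \<epsilon> B B' * \<epsilon> B' B'') =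
        (\<Sum>B' | B' \<in> ?X \<and> cell_facet B' B \<and> cell_facet B'' B'. \<epsilon> B B' * \<epsilon> B' B'')"
      using finite_bounded_complex facet that by (intro sum.mono_neutral_right) auto
    then show ?thesis
      using assms that by (simp add: incidence_function_def)
  qed
  show ?thesis
  proof
    show "finite ?X" by (rule finite_bounded_complex)
    show "{} \<in> ?X" by (simp add: bounded_complex_def)
    show "cell_label n v P {} = (\<lambda>i. 0)" by (rule cell_label_empty)
    fix B assume B: "B \<in> ?X"
    show "cell_rank B = 0 \<longleftrightarrow> B = {}"
      by (simp add: cell_rank_eq_iff aff_dim_empty)
    show "\<epsilon> B {} = 1" if "cell_rank B = 1"
      using that B by (simp add: cell_rank_eq_iff bottom)
    fix B' assume B': "B' \<in> ?X"
    show "\<epsilon> B B' \<in> {0, 1, -1}" by (rule incidence[OF B B'])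
    show "cell_facet B' B \<longleftrightarrow> \<epsilon> B B' \<noteq> 0" using facet[OF B B'] by simp
    show "cell_rank B = Suc (cell_rank B')" if "\<epsilon> B B' \<noteq> 0"
      using that facet[OF B B'] cell_facet_rank by simp
    show "cell_label n v P B' < cell_label n v P B" if "\<epsilon> B B' \<noteq> 0"
      using that facet[OF B B'] cell_label_less[OF B B'] by simp
    show "(\<Sum>B''\<in>?X. \<epsilon> B B'' * \<epsilon> B'' B') = 0" by (rule sum[OF B B'])
  qed
qed

text \<open>Cells are plain point sets; this and \<open>cell_downs\<close> recover the index sets,
  so that the matchings can be written as functions of the cell.\<close>

definition cell_ups :: "(real ^ 'n) set \<Rightarrow> nat set" where
  "cell_ups C = (\<Union>q\<in>C. ups q)"

definition cell_downs :: "(real ^ 'n) set \<Rightarrow> nat set" where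
  "cell_downs C = (\<Union>q\<in>C. downs q)"

lemma cell_ups_downs_Cell:
  assumes "valid A B"
  shows "cell_ups (Cell A B) = A" "cell_downs (Cell A B) = B"
proof -
  note AB = validD[OF assms]
  obtain p where p: "p \<in> U" "ups p = A" "downs p = B"
    using valid_interior_point[OF assms] by blast
  then have "p \<in> Cell A B" using mem_Cell_ups_downs by blast
  moreover have "ups q \<subseteq> A" "downs q \<subseteq> B" if "q \<in> Cell A B" for q
    using that by (force simp: Cell_def ups_def downs_def)+
  ultimately show "cell_ups (Cell A B) = A" "cell_downs (Cell A B) = B"
    using p by (auto simp: cell_ups_def cell_downs_def)
qed

lemma cell_ups_downs_empty [simp]: "cell_ups {} = {}" "cell_downs {} = {}"
  by (simp_all add: cell_ups_def cell_downs_def)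


section \<open>Acyclicity\<close>

text \<open>Says that \<open>Cell {a} {b}\<close> is a 0-cell of the subcomplex for
  \<open>u\<close>. The admissible pairs form a bipartite graph whose complete bipartite subgraphs
  with two nonempty sides are the nonempty cells of the subcomplex.\<close>

definition admissible :: "('n \<Rightarrow> nat) \<Rightarrow> nat \<Rightarrow> nat \<Rightarrow> bool" where
  "admissible u a b \<longleftrightarrow> a \<in> relevant \<and> b \<in> relevant \<and> a < b \<and>
     (\<forall>i\<in>{1..n}. of_bool (i = a) + of_bool (i + 1 = b) \<le> u (w i))"

text \<open>For each \<open>i\<close> some pair of \<open>A \<times> B\<close> already attains the
  exponent of the whole cell, so the bound can be tested on pairs.\<close>

lemma label_le_iff_admissible:
  assumes "valid A B"
  shows "cell_label n v P (Cell A B) \<le> u \<longleftrightarrow> (\<forall>a\<in>A. \<forall>b\<in>B. admissible u a b)"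
proof -
  note AB = validD[OF assms]
  show ?thesis
    unfolding cell_label_Cell_le_iff[OF assms]
  proof (intro iffI ballI)
    fix a b assume le: "\<forall>i\<in>{1..n}. of_bool (i \<in> A) + of_bool (i + 1 \<in> B) \<le> u (w i)"
      and ab: "a \<in> A" "b \<in> B"
    have "of_bool (i = a) + of_bool (i + 1 = b) \<le> u (w i)" if "i \<in> {1..n}" for i
    proof -
      have "of_bool (i = a) + of_bool (i + 1 = b) \<le> (of_bool (i \<in> A) + of_bool (i + 1 \<in> B) :: nat)"
        using ab by (intro add_mono) auto
      then show ?thesis using le that order_trans by blast
    qed
    then show "admissible u a b"
      using ab AB(3,4,10) unfolding admissible_def by blast
  next
    fix i assume adm: "\<forall>a\<in>A. \<forall>b\<in>B. admissible u a b" and i: "i \<in> {1..n}"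
    obtain a0 b0 where 0: "a0 \<in> A" "b0 \<in> B" using AB(1,2) by blast
    define a where "a = (if i \<in> A then i else a0)"
    define b where "b = (if i + 1 \<in> B then i + 1 else b0)"
    have "a \<in> A" "b \<in> B" using 0 by (simp_all add: a_def b_def)
    then have "of_bool (i = a) + of_bool (i + 1 = b) \<le> u (w i)"
      using adm i unfolding admissible_def by blast
    moreover have "of_bool (i \<in> A) + of_bool (i + 1 \<in> B) \<le> (of_bool (i = a) + of_bool (i + 1 = b) :: nat)"
      unfolding a_def b_def by (intro add_mono) auto
    ultimately show "of_bool (i \<in> A) + of_bool (i + 1 \<in> B) \<le> u (w i)"
      by (rule order_trans[rotated])
  qed
qed

text \<open>The neighbourhoods of the possible ups form a chain, which is why a common coface can be found.\<close>

lemma admissible_mono: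
  assumes "admissible u a b" "admissible u a' b'" "a' \<le> a"
  shows "admissible u a' b"
  unfolding admissible_def
proof (intro conjI ballI)
  fix i assume i: "i \<in> {1..n}"
  have le: "of_bool (i = a) + of_bool (i + 1 = b) \<le> u (w i)" "of_bool (i = a') + of_bool (i + 1 = b') \<le> u (w i)"
    using assms i unfolding admissible_def by blast+
  have "a < b" using assms by (simp add: admissible_def)
  show "of_bool (i = a') + of_bool (i + 1 = b) \<le> u (w i)"
  \<comment> \<open>Exponent 2 is needed only in the first case, where \<open>a < b = a' + 1\<close>
    forces \<open>a = a'\<close>. Otherwise at most one indicator is 1, and one of the two given
    bounds covers it.\<close>
  proof (cases "i = a' \<and> i + 1 = b")
    case True
    then have "a = a'" using \<open>a < b\<close> assms(3) by auto
    then show ?thesis using le(1) by simp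
  next
    case False
    then show ?thesis using le by (auto split: if_splits simp: of_bool_def)
  qed
qed (use assms in \<open>auto simp: admissible_def\<close>)

lemma valid_if_admissible:
  "A \<noteq> {} \<Longrightarrow> B \<noteq> {} \<Longrightarrow> \<forall>a\<in>A. \<forall>b\<in>B. admissible u a b \<Longrightarrow> valid A B"
  unfolding valid_def admissible_def by blast

lemma acyclic:
  fixes f :: "(real ^ 'n) set \<Rightarrow> 'k::field"
  assumes \<epsilon>: "incidence_function (bounded_complex n v P) \<epsilon>"
    and chain: "cell_complex.chain cell_rank
      (labelled_complex.subcomplex (bounded_complex n v P) (cell_label n v P) u) (Suc r) f"
    and cycle: "cell_complex.cycle (bounded_complex n v P) \<epsilon> f"
  shows "\<exists>g. cell_complex.chain cell_rank
      (labelled_complex.subcomplex (bounded_complex n v P) (cell_label n v P) u) (Suc (Suc r)) g \<and>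
      (\<forall>B\<in>bounded_complex n v P. cell_complex.boundary (bounded_complex n v P) \<epsilon> g B = f B)"
proof -
  let ?X = "bounded_complex n v P"
  interpret labelled_complex ?X cell_rank \<epsilon> "{}" cell_facet "cell_label n v P"
    by (rule labelled_complex[OF \<epsilon>])
  let ?G = "admissible u"
  show ?thesis
  proof (cases "\<exists>C. f C \<noteq> 0")
    case False
    then show ?thesis by (intro exI[of _ "\<lambda>_. 0"]) (auto simp: chain_def boundary_def)
  next
    case True
    define S where "S = subcomplex u"
    have S_iff: "Cell A B \<in> S \<longleftrightarrow> (\<forall>a\<in>A. \<forall>b\<in>B. ?G a b)" if "valid A B" for A B
      using that by (simp add: S_def subcomplex_def Cell_in_bounded_complex label_le_iff_admissible)
    have SX: "S \<subseteq> ?X" by (auto simp: S_def subcomplex_def)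
    have empty_S: "{} \<in> S"
      using bottom_in by (simp add: S_def subcomplex_def label_bottom le_fun_def)
    \<comment> \<open>The support of \<open>f\<close> has positive rank and so supplies a nonempty
      cell, hence an admissible pair.\<close>
    obtain C where C: "C \<in> S" "cell_rank C = Suc r"
      using True chain by (auto simp: chain_def S_def)
    obtain A B where AB: "C = Cell A B" "valid A B"
    proof -
      have "C \<in> ?X" "C \<noteq> {}" using C SX rank_0[OF bottom_in] by auto
      then show ?thesis using that by (auto elim: bounded_complex_cases)
    qed
    then obtain a1 b1 where ab1: "?G a1 b1"
      using S_iff C(1) validD(1,2)[OF AB(2)] by blast
    \<comment> \<open>The least up with an admissible partner is admissible with every down that has
      any partner, so it may be added to every nonempty cell.\<close>
    define a where "a = (LEAST a. \<exists>b. ?G a b)"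
    obtain b where ab: "?G a b"
      using LeastI[of "\<lambda>a. \<exists>b. ?G a b" a1] ab1 unfolding a_def by blast
    have least: "?G a b'" if "?G a' b'" for a' b'
    proof (rule admissible_mono[OF that ab])
      show "a \<le> a'" unfolding a_def using that by (intro Least_le) blast
    qed

    define D where "D = {Cell A B | A B. valid A B \<and> Cell A B \<in> S \<and> a \<notin> A}"
    define M where "M C = Cell (insert a (cell_ups C)) (cell_downs C)" for C
    have valid_insert: "valid (insert a A) B \<and> Cell (insert a A) B \<in> S" if "valid A B" "Cell A B \<in> S" for A B
    proof -
      have G: "\<forall>a'\<in>insert a A. \<forall>b\<in>B. ?G a' b"
        using that S_iff[OF that(1)] validD(1)[OF that(1)] least by blast
      then have "valid (insert a A) B"
        using validD(2)[OF that(1)] by (intro valid_if_admissible) auto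
      then show ?thesis using G S_iff by blast
    qed
    have M_Cell: "M (Cell A B) = Cell (insert a A) B" if "valid A B" for A B
      by (simp add: M_def cell_ups_downs_Cell[OF that])
    obtain g f' where g: "chain S (Suc (Suc r)) g" and f': "chain (S - D - M ` D) (Suc r) f'" "cycle f'"
      and fg: "\<And>B. B \<in> ?X \<Longrightarrow> f B = boundary g B + f' B"
    proof (rule matching_reduction[of S D M "Suc r" f])
      show "S \<subseteq> ?X" by (rule SX)
      show "D \<subseteq> S" by (auto simp: D_def)
      show "M ` D \<subseteq> S - D"
      proof
        fix y assume "y \<in> M ` D"
        then obtain A B where AB: "valid A B" "Cell A B \<in> S" "a \<notin> A" "y = M (Cell A B)"
          by (auto simp: D_def)
        have y: "y = Cell (insert a A) B" using AB M_Cell by simp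
        have "y \<notin> D"
        proof
          assume "y \<in> D"
          then obtain A' B' where A': "y = Cell A' B'" "valid A' B'" "a \<notin> A'" by (auto simp: D_def)
          have "Cell A' B' = Cell (insert a A) B"
            using A'(1) y by (rule trans[OF sym])
          then have "A' = insert a A"
            using Cell_eq_iff[OF conjunct1[OF valid_insert[OF AB(1,2)]] A'(2)] by blast
          then show False using A'(3) by simp
        qed
        then show "y \<in> S - D" using y valid_insert[OF AB(1,2)] by simp
      qed
      show "B' \<in> S" if "B \<in> S" "B' \<in> ?X" "\<epsilon> B B' \<noteq> 0" for B B'
        using that label_less[of B B'] unfolding S_def subcomplex_def by auto
      show "\<epsilon> (M c) c \<noteq> 0" if c: "c \<in> D" for c
      proof -
        obtain A B where AB: "valid A B" "Cell A B \<in> S" "a \<notin> A" "c = Cell A B"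
          using c by (auto simp: D_def)
        have "cell_facet c (M c)"
          using AB valid_insert[OF AB(1,2)] validD(5)[OF AB(1)]
          by (auto simp: M_Cell cell_facet_Cell_iff)
        then show ?thesis
          using facet_iff AB valid_insert[OF AB(1,2)] by (simp add: M_Cell Cell_in_bounded_complex)
      qed
      show "inj_on M D"
      proof (rule inj_onI)
        fix x y assume "x \<in> D" "y \<in> D" and eq: "M x = M y"
        then obtain A B A' B' where AB: "valid A B" "Cell A B \<in> S" "a \<notin> A" "x = Cell A B"
          and A': "valid A' B'" "Cell A' B' \<in> S" "a \<notin> A'" "y = Cell A' B'"
          by (auto simp: D_def)
        have "insert a A' = insert a A" "B' = B"
          using eq AB A' valid_insert[OF AB(1,2)] valid_insert[OF A'(1,2)]
          by (simp_all add: M_Cell Cell_eq_iff)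
        then show "x = y" using AB A' by (metis insert_ident)
      qed
      \<comment> \<open>The coface \<open>C\<close> is nonempty and its ups contain
        \<open>a\<close>. Having just one index more than \<open>c\<close>, it can differ from it
        only by \<open>a\<close>.\<close>
      show "C = M c" if c: "c \<in> D" and C: "C \<in> S - D" "\<epsilon> C c \<noteq> 0" for c C
      proof -
        obtain A B where AB: "valid A B" "Cell A B \<in> S" "a \<notin> A" "c = Cell A B"
          using c by (auto simp: D_def)
        have CX: "C \<in> ?X" using C SX by blast
        have facet: "cell_facet c C"
          using facet_iff[OF CX] C(2) AB by (simp add: Cell_in_bounded_complex)
        from CX show ?thesis
        proof (cases rule: bounded_complex_cases)
          case 1
          then show ?thesis using facet not_cell_facet_of_empty by simp
        next
          case (2 A' B')
          have sub: "A \<subseteq> A'" "B \<subseteq> B'" "card A' + card B' = Suc (card A + card B)"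
            using facet AB 2 by (auto simp: cell_facet_Cell_iff)
          have "a \<in> A'" using C(1) 2 by (auto simp: D_def)
          then have "insert a A \<subseteq> A'" using sub by simp
          note fin = validD(5,6)[OF 2(2)] validD(5)[OF AB(1)]
          have "card (insert a A) \<le> card A'" "card B \<le> card B'"
            using \<open>insert a A \<subseteq> A'\<close> sub(2) fin by (auto intro: card_mono)
          then have "card A' = card (insert a A)" "card B' = card B"
            using sub(3) fin(3) AB(3) by auto
          then have "A' = insert a A" "B' = B"
            using \<open>insert a A \<subseteq> A'\<close> sub(2) fin card_subset_eq by metis+
          then show ?thesis using 2 AB M_Cell by simp
        qed
      qed
      show "chain S (Suc r) f" using chain by (simp add: S_def)
    qed (use cycle in blast)+

    define N where "N = {b. ?G a b}"
    have N: "finite N" "b \<in> N"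
      using ab finite_subset[OF _ finite_relevant, of N] by (auto simp: N_def admissible_def)
    \<comment> \<open>Faces of the simplex with vertex set \<open>N\<close>. Sending the empty set
      to the empty cell makes facets correspond in all ranks, in particular the empty cell to the
      0-cells.\<close>
    define E where "E B = (if B = {} then {} else Cell {a} B)" for B
    have valid_a: "valid {a} B" if "B \<subseteq> N" "B \<noteq> {}" for B
      using that by (intro valid_if_admissible[of _ _ u]) (auto simp: N_def)
    have E_S: "E B \<in> S" if "B \<subseteq> N" for B
      using that valid_a empty_S by (auto simp: E_def S_iff N_def)
    have E_downs: "cell_downs (E B) = B" if "B \<subseteq> N" for B
      using that valid_a cell_ups_downs_Cell(2) by (simp add: E_def)
    have E_eq: "B' = B" if "E B' = E B" "B \<subseteq> N" "B' \<subseteq> N" for B B'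
      using that E_downs by metis
    have E_facet: "cell_facet (E B') (E B) \<longleftrightarrow> B' \<subseteq> B \<and> card B = Suc (card B')"
      if "B \<subseteq> N" "B' \<subseteq> N" for B B'
    proof (cases "B = {}")
      case True
      then show ?thesis using not_cell_facet_of_empty by (simp add: E_def)
    next
      case False
      then show ?thesis
        using that valid_a by (simp add: E_def cell_facet_Cell_iff cell_facet_empty_iff)
    qed
    define S' where "S' = E ` Pow N"
    define D' where "D' = E ` Pow (N - {b})"
    define M' where "M' C = E (insert b (cell_downs C))" for C
    have M'_E: "M' (E B) = E (insert b B)" if "B \<subseteq> N" for B
      using that by (simp add: M'_def E_downs)
    have S'S: "S' \<subseteq> S" using E_S by (auto simp: S'_def)
    \<comment> \<open>An unmatched nonempty cell has \<open>a\<close> among its ups; with a further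
      up it would be the partner of the cell obtained by deleting \<open>a\<close>.\<close>
    have rest: "S - D - M ` D \<subseteq> S'"
    proof
      fix C assume C: "C \<in> S - D - M ` D"
      then have "C \<in> ?X" using SX by blast
      then show "C \<in> S'"
      proof (cases rule: bounded_complex_cases)
        case 1
        then have "C = E {}" by (simp add: E_def)
        then show ?thesis unfolding S'_def by blast
      next
        case (2 A B)
        then have "a \<in> A" using C by (auto simp: D_def)
        have G: "\<forall>a\<in>A. \<forall>b\<in>B. ?G a b" using S_iff[OF 2(2)] C 2(1) by blast
        have "A - {a} = {}"
        proof (rule ccontr)
          assume "A - {a} \<noteq> {}"
          then have valid: "valid (A - {a}) B"
            using valid_subset[OF 2(2), of "A - {a}" B] validD(2)[OF 2(2)] by blast
          then have "Cell (A - {a}) B \<in> D"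
            using G S_iff[OF valid] by (auto simp: D_def)
          moreover have "C = M (Cell (A - {a}) B)"
            using 2 \<open>a \<in> A\<close> by (simp add: M_Cell[OF valid] insert_absorb)
          ultimately show False using C by blast
        qed
        then have "A = {a}" using \<open>a \<in> A\<close> by blast
        then have "C = E B" "B \<subseteq> N"
          using 2 validD(2)[OF 2(2)] G by (auto simp: E_def N_def)
        then show ?thesis unfolding S'_def by blast
      qed
    qed
    obtain g' f'' where g': "chain S' (Suc (Suc r)) g'" and f'': "chain (S' - D' - M' ` D') (Suc r) f''"
      and fg': "\<And>B. B \<in> ?X \<Longrightarrow> f' B = boundary g' B + f'' B"
    proof (rule matching_reduction[of S' D' M' "Suc r" f'])
      show "S' \<subseteq> ?X" using S'S SX by blast
      show "D' \<subseteq> S'" by (auto simp: S'_def D'_def)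
      show "M' ` D' \<subseteq> S' - D'"
      proof
        fix y assume "y \<in> M' ` D'"
        then obtain B where B: "B \<subseteq> N - {b}" "y = M' (E B)" by (auto simp: D'_def)
        then have "B \<subseteq> N" by blast
        then have y: "y = E (insert b B)" using B M'_E by simp
        have "y \<notin> D'"
        proof
          assume "y \<in> D'"
          then obtain B' where B': "B' \<subseteq> N - {b}" "y = E B'" by (auto simp: D'_def)
          then have "insert b B = B'" using y E_eq[of "insert b B" B'] B N(2) by blast
          then show False using B'(1) by blast
        qed
        moreover have "y \<in> S'" using y \<open>B \<subseteq> N\<close> N(2) by (auto simp: S'_def)
        ultimately show "y \<in> S' - D'" by blast
      qed
      \<comment> \<open>A nonempty facet cannot lose its only up, so it is again
        \<open>Cell {a} B'\<close>.\<close>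
      show "C' \<in> S'" if C: "C \<in> S'" "C' \<in> ?X" "\<epsilon> C C' \<noteq> 0" for C C'
      proof -
        obtain B where B: "B \<subseteq> N" "C = E B" using C(1) by (auto simp: S'_def)
        have facet: "cell_facet C' C" using facet_iff[of C C'] C S'S SX by blast
        then have "B \<noteq> {}" using not_cell_facet_of_empty B by (auto simp: E_def)
        from C(2) show ?thesis
        proof (cases rule: bounded_complex_cases)
          case 1
          then have "C' = E {}" by (simp add: E_def)
          then show ?thesis unfolding S'_def by blast
        next
          case (2 A' B')
          have "A' \<subseteq> {a}" "B' \<subseteq> B"
            using facet 2 B \<open>B \<noteq> {}\<close> valid_a[OF B(1)] by (auto simp: E_def cell_facet_Cell_iff)
          then have "C' = E B'" "B' \<subseteq> N"
            using 2 validD(1,2)[OF 2(2)] B(1) by (auto simp: E_def subset_singleton_iff)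
          then show ?thesis unfolding S'_def by blast
        qed
      qed
      show "\<epsilon> (M' c) c \<noteq> 0" if c: "c \<in> D'" for c
      proof -
        obtain B where B: "B \<subseteq> N - {b}" "c = E B" using c by (auto simp: D'_def)
        then have sub: "B \<subseteq> N" "insert b B \<subseteq> N" "b \<notin> B" "finite B"
          using N finite_subset[of B N] by auto
        have "cell_facet c (M' c)"
          using B sub by (auto simp: M'_E E_facet)
        moreover have "c \<in> ?X" "M' c \<in> ?X"
          using E_S sub SX B by (auto simp: M'_E)
        ultimately show ?thesis using facet_iff by blast
      qed
      show "inj_on M' D'"
      proof (rule inj_onI)
        fix x y assume "x \<in> D'" "y \<in> D'" and eq: "M' x = M' y"
        then obtain B B' where B: "B \<subseteq> N - {b}" "x = E B" and B': "B' \<subseteq> N - {b}" "y = E B'"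
          by (auto simp: D'_def)
        then have "B \<subseteq> N" "B' \<subseteq> N" "b \<notin> B" "b \<notin> B'" by auto
        then have "E (insert b B) = E (insert b B')" using eq B B' by (simp add: M'_E)
        then have "insert b B = insert b B'"
          using E_eq[of "insert b B" "insert b B'"] \<open>B \<subseteq> N\<close> \<open>B' \<subseteq> N\<close> N(2) by blast
        then show "x = y" using B B' \<open>b \<notin> B\<close> \<open>b \<notin> B'\<close> by (metis insert_ident)
      qed
      show "C = M' c" if c: "c \<in> D'" and C: "C \<in> S' - D'" "\<epsilon> C c \<noteq> 0" for c C
      proof -
        obtain B where B: "B \<subseteq> N - {b}" "c = E B" using c by (auto simp: D'_def)
        then have BN: "B \<subseteq> N" "b \<notin> B" by auto
        obtain B' where B': "B' \<subseteq> N" "C = E B'" using C(1) by (auto simp: S'_def)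
        have "b \<in> B'" using C(1) B' by (auto simp: D'_def)
        have "cell_facet c C"
          using facet_iff[of C c] C B B' BN E_S SX by blast
        then have sub: "B \<subseteq> B'" "card B' = Suc (card B)"
          using E_facet[OF B'(1) BN(1)] B B' by auto
        have "insert b B = B'"
        proof (rule card_subset_eq)
          show "finite B'" using B' N finite_subset by blast
          with sub(1) have "finite B" by (rule finite_subset)
          then show "card (insert b B) = card B'"
            using sub BN by simp
        qed (use sub \<open>b \<in> B'\<close> in blast)
        then show ?thesis using B' B M'_E[OF BN(1)] by simp
      qed
      show "chain S' (Suc r) f'" using f'(1) rest unfolding chain_def by blast
    qed (use f'(2) in blast)+
    \<comment> \<open>Adding or removing \<open>b\<close> pairs off all subsets of \<open>N\<close>:
      the simplex is a cone with apex \<open>b\<close>. Nothing remains, so the cycle is a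
      boundary.\<close>
    have "S' - D' - M' ` D' = {}"
    proof -
      have "E B \<in> D' \<union> M' ` D'" if "B \<subseteq> N" for B
      proof (cases "b \<in> B")
        case True
        then have "E (B - {b}) \<in> D'" "M' (E (B - {b})) = E B"
          using that M'_E[of "B - {b}"] by (auto simp: D'_def insert_absorb)
        then show ?thesis by (metis UnI2 image_eqI)
      next
        case False
        then show ?thesis using that by (auto simp: D'_def)
      qed
      then show ?thesis by (auto simp: S'_def)
    qed
    then have "f'' B = 0" for B using f'' by (auto simp: chain_def)
    then have "boundary (\<lambda>B. g B + g' B) B = f B" if "B \<in> ?X" for B
      using fg[OF that] fg'[OF that] by (simp add: boundary_add)
    moreover have "chain S (Suc (Suc r)) (\<lambda>B. g B + g' B)"
      unfolding chain_def
    proof (intro allI impI)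
      fix B assume "g B + g' B \<noteq> 0"
      then have "g B \<noteq> 0 \<or> g' B \<noteq> 0" by auto
      then show "B \<in> S \<and> cell_rank B = Suc (Suc r)"
        using g g' S'S unfolding chain_def by blast
    qed
    ultimately show ?thesis unfolding S_def by blast
  qed
qed

text \<open>A union of parts either contains \<open>Vk\<close> or misses it entirely, so the
  condition on \<open>Vk\<close> amounts to missing \<open>v n\<close>. The remaining sets are the
  stretches between relevant edges, that is, the 0-cells.\<close>

lemma parking_ideal_eq:
  assumes "Vk \<in> P" "v n \<in> Vk"
  shows "(parking_ideal (cycle_edges n v) P Vk :: ('n, 'k::field) mpoly set) =
    ideal_gen {monom (cell_label n v P B) | B. B \<in> bounded_complex n v P \<and> cell_rank B = 1}"
proof -
  have "{monom (out_degree (cycle_edges n v) S) | S. connected_parset (cycle_edges n v) P S \<and> \<not> Vk \<subseteq> S} =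
      {monom (cell_label n v P B) :: ('n, 'k) mpoly | B. B \<in> bounded_complex n v P \<and> cell_rank B = 1}"
      (is "?L = ?R")
  proof (intro equalityI subsetI)
    fix m assume "m \<in> ?L"
    then obtain S where S: "m = monom (out_degree (cycle_edges n v) S)"
      "connected_parset (cycle_edges n v) P S" "\<not> Vk \<subseteq> S" by blast
    have "w n \<notin> S"
      using S(2,3) assms part_absorbs[of _ Vk "w n"] by (auto simp: connected_parset_def w_n)
    then obtain a b where ab: "a \<in> relevant" "b \<in> relevant" "a < b" "S = stretch a b"
      using stretch_if_connected_parset[OF S(2)] by blast
    have "Cell {a} {b} \<in> bounded_complex n v P" "cell_rank (Cell {a} {b}) = 1"
      using Cell_singleton(1)[OF ab(1-3)] by (simp_all add: Cell_in_bounded_complex cell_rank_Cell)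
    moreover have "m = monom (cell_label n v P (Cell {a} {b}))"
      by (simp add: S(1) ab cell_label_singleton)
    ultimately show "m \<in> ?R" by blast
  next
    fix m assume "m \<in> ?R"
    then obtain C where C: "m = monom (cell_label n v P C)" "C \<in> bounded_complex n v P" "cell_rank C = 1"
      by blast
    from C(2) obtain A B where AB: "C = Cell A B" "valid A B"
    proof (cases rule: bounded_complex_cases)
      case 1
      then show ?thesis using C(3) by (simp add: cell_rank_eq_iff)
    qed blast
    have "card A = 1" "card B = 1"
      using C(3) card_valid_pos[OF AB(2)] by (auto simp: AB(1) cell_rank_Cell[OF AB(2)])
    then obtain a b where ab: "A = {a}" "B = {b}" by (metis card_1_singletonE)
    then have rel: "a \<in> relevant" "b \<in> relevant" "a < b"
      using validD(3,4,10)[OF AB(2)] by auto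
    have "m = monom (out_degree (cycle_edges n v) (stretch a b))"
      unfolding C(1) AB(1) ab cell_label_singleton[OF rel] ..
    moreover have "\<not> Vk \<subseteq> stretch a b"
      using connected_parset_stretch(2)[OF rel] assms(2) by (auto simp: w_n)
    ultimately show "m \<in> ?L" using connected_parset_stretch(1)[OF rel] by blast
  qed
  then show ?thesis by (simp only: parking_ideal_def)
qed

end

theorem theorem1p3:
  fixes n :: nat and v :: "nat \<Rightarrow> 'n::finite" and P :: "'n set set" and Vk :: "'n set"
    and \<epsilon> :: "(real ^ 'n) set \<Rightarrow> (real ^ 'n) set \<Rightarrow> int"
  assumes "parcycle n v P"
    and "Vk \<in> P" and "v n \<in> Vk"
    and "incidence_function (bounded_complex n v P) \<epsilon>"
  shows "minimal_free_resolution (cell_basis n v P) (cell_label n v P)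
           (cellular_differential n v P \<epsilon>)
           (\<lambda>f. Poly_Mapping.lookup f {})
           (parking_ideal (cycle_edges n v) P Vk :: ('n, 'k::field) mpoly set)"
proof -
  interpret parcycle_setting n v P
    by unfold_locales (rule assms(1))
  interpret labelled_complex "bounded_complex n v P" cell_rank \<epsilon> "{}" cell_facet "cell_label n v P"
    by (rule labelled_complex[OF assms(4)])
  have "cell_basis n v P = (\<lambda>i. {B \<in> bounded_complex n v P. cell_rank B = i})"
    by (simp add: fun_eq_iff cell_basis_def cell_rank_eq_iff)
  moreover have "cellular_differential n v P \<epsilon> = (differential :: _ \<Rightarrow> _ \<Rightarrow>\<^sub>0 ('n, 'k) mpoly)"
    by (simp only: fun_eq_iff cellular_differential_def differential_def) simp
  moreover have "minimal_free_resolution (\<lambda>i. {B \<in> bounded_complex n v P. cell_rank B = i})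
      (cell_label n v P) differential (\<lambda>f. lookup f {})
      (ideal_gen {monom (cell_label n v P B) | B. B \<in> bounded_complex n v P \<and> cell_rank B = 1} ::
        ('n, 'k) mpoly set)"
    by (rule minimal_resolution) (rule acyclic[OF assms(4)])
  ultimately show ?thesis
    by (simp only: parking_ideal_eq[OF assms(2,3)])
qed


end
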